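(* For each $d$ there exists a constant $C_d$ such that for every triangulated compact manifold $(M,T)$ without boundary of dimension $d$, there exists a piecewise Riemannian metric $m$ on $M$ with volume $f_d(T)$ such that for every closed curve $\gamma$ in $M$, there exists a closed curve $\gamma'$ on the $1$-skeleton $G$ of $T$, homotopic to $\gamma$ in $M$, with $$|\gamma'|_{G}\leq C_d\, |\gamma|_m.$$
   Context: A triangulated $d$-manifold $(M,T)$ is a $d$-manifold $M$ obtained as the underlying space of a simplicial complex $T$ (more generally, of a gluing of $d$-simplices along their facets in which faces of the same $d$-simplex may become identified). $f_d(T)$ is the number of $d$-dimensional simplices of $T$. A piecewise Riemannian metric on $(M,T)$ is a metric given by a Riemannian metric on each simplex, compatible along common faces (for instance, each $d$-simplex endowed with the geometry of a regular Euclidean simplex of a fixed volume, glued by facewise isometries); lengths and volumes are defined by restriction to each simplex, and $|\gamma|_m$ is the length of $\gamma$. Closed curves on the $1$-skeleton $G$ are closed walks in the graph $G$ (possibly a single vertex), and $|\gamma'|_G$ is the number of edges traversed by $\gamma'$, counted with multiplicity. *)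

theory Defs
  imports
    "HOL-Homology.Homology"
    "HOL-Probability.Probability"
    "HOL-Combinatorics.Permutations"
    "Jordan_Normal_Form.Determinant"
    "Graph_Theory.Arc_Walk"
begin

section \<open>Gluings of simplices\<close>

text \<open>A combinatorial gluing of \<open>d\<close>-simplices: the simplices are numbered \<open>0, ..., num_simplices - 1\<close>,
  and the vertices of each of them \<open>0, ..., d\<close>. The facet of simplex \<open>s\<close> opposite to vertex \<open>k\<close> is
  called \<open>(s, k)\<close>. The entry \<open>gluing T s k = Some (s', \<pi>)\<close> means that this facet is identified
  with the facet \<open>(s', \<pi> k)\<close> by the affine map sending vertex \<open>j \<noteq> k\<close> of \<open>s\<close> to vertex \<open>\<pi> j\<close> of
  \<open>s'\<close>; \<open>None\<close> means that the facet is not glued to anything. The simplices \<open>s\<close> and \<open>s'\<close> may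
  coincide, and two simplices may share several facets.\<close>

record triangulation =
  num_simplices :: nat
  gluing :: "nat \<Rightarrow> nat \<Rightarrow> (nat \<times> (nat \<Rightarrow> nat)) option"

definition is_gluing :: "nat \<Rightarrow> triangulation \<Rightarrow> bool" where
  "is_gluing d T \<longleftrightarrow>
    (\<forall>s<num_simplices T. \<forall>k\<le>d. \<forall>s' \<pi>. gluing T s k = Some (s', \<pi>) \<longrightarrow>
      s' < num_simplices T \<and> \<pi> permutes {..d} \<and> (s', \<pi> k) \<noteq> (s, k) \<and>
      gluing T s' (\<pi> k) = Some (s, inv_into UNIV \<pi>))"

type_synonym spoint = "nat \<times> (nat \<Rightarrow> real)"

definition simplices_points :: "nat \<Rightarrow> triangulation \<Rightarrow> spoint set" where
  "simplices_points d T = {..<num_simplices T} \<times> standard_simplex d"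

definition simplices_topology :: "nat \<Rightarrow> triangulation \<Rightarrow> spoint topology" where
  "simplices_topology d T =
    prod_topology (discrete_topology {..<num_simplices T}) (top_of_set (standard_simplex d))"

text \<open>Points are given by barycentric coordinates, so the affine map that sends vertex \<open>j\<close> to
  vertex \<open>\<pi> j\<close> is \<open>x \<mapsto> x \<circ> inv_into UNIV \<pi>\<close>.\<close>

definition facet_identification :: "nat \<Rightarrow> triangulation \<Rightarrow> (spoint \<times> spoint) set" where
  "facet_identification d T =
    {((s, x), (s', x \<circ> inv_into UNIV \<pi>)) | s x s' \<pi>.
      s < num_simplices T \<and> x \<in> standard_simplex d \<and>
      (\<exists>k\<le>d. x k = 0 \<and> gluing T s k = Some (s', \<pi>))}"

definition gluing_rel :: "nat \<Rightarrow> triangulation \<Rightarrow> (spoint \<times> spoint) set" where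
  "gluing_rel d T = (facet_identification d T \<union> (facet_identification d T)\<inverse>)\<^sup>*"

definition point_class :: "nat \<Rightarrow> triangulation \<Rightarrow> spoint \<Rightarrow> spoint set" where
  "point_class d T p = gluing_rel d T `` {p}"

definition underlying_space :: "nat \<Rightarrow> triangulation \<Rightarrow> spoint set topology" where
  "underlying_space d T =
    topology (\<lambda>U. U \<subseteq> point_class d T ` simplices_points d T \<and>
      openin (simplices_topology d T) {p \<in> simplices_points d T. point_class d T p \<in> U})"

lemma topspace_simplices_topology [simp]:
  "topspace (simplices_topology d T) = simplices_points d T"
  by (simp add: simplices_topology_def simplices_points_def)

lemma openin_underlying_space:
  "openin (underlying_space d T) U \<longleftrightarrow> U \<subseteq> point_class d T ` simplices_points d T \<and>
      openin (simplices_topology d T) {p \<in> simplices_points d T. point_class d T p \<in> U}"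
proof -
  let ?Q = "\<lambda>U. U \<subseteq> point_class d T ` simplices_points d T \<and>
      openin (simplices_topology d T) {p \<in> simplices_points d T. point_class d T p \<in> U}"
  have "istopology ?Q"
    unfolding istopology_def
  proof (intro conjI allI impI)
    fix S S' assume "?Q S" "?Q S'"
    moreover have "{p \<in> simplices_points d T. point_class d T p \<in> S \<inter> S'} =
        {p \<in> simplices_points d T. point_class d T p \<in> S} \<inter> {p \<in> simplices_points d T. point_class d T p \<in> S'}"
      by blast
    ultimately show "S \<inter> S' \<subseteq> point_class d T ` simplices_points d T"
      and "openin (simplices_topology d T) {p \<in> simplices_points d T. point_class d T p \<in> S \<inter> S'}"
      by auto
  next
    fix \<K> assume K: "\<forall>K\<in>\<K>. ?Q K"
    then show "\<Union>\<K> \<subseteq> point_class d T ` simplices_points d T" by blast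
    have "{p \<in> simplices_points d T. point_class d T p \<in> \<Union>\<K>} =
        (\<Union>K\<in>\<K>. {p \<in> simplices_points d T. point_class d T p \<in> K})"
      by blast
    with K show "openin (simplices_topology d T) {p \<in> simplices_points d T. point_class d T p \<in> \<Union>\<K>}"
      by auto
  qed
  then show ?thesis
    by (simp add: underlying_space_def)
qed

lemma topspace_underlying_space:
  "topspace (underlying_space d T) = point_class d T ` simplices_points d T"
proof -
  have "{p \<in> simplices_points d T. point_class d T p \<in> point_class d T ` simplices_points d T} =
      topspace (simplices_topology d T)"
    by auto
  then have "openin (underlying_space d T) (point_class d T ` simplices_points d T)"
    unfolding openin_underlying_space by (metis openin_topspace order_refl)
  then show ?thesis
    by (meson openin_subset openin_topspace openin_underlying_space subset_antisym)
qed

lemma quotient_map_point_class: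
  "quotient_map (simplices_topology d T) (underlying_space d T) (point_class d T)"
  by (auto simp: quotient_map_def topspace_underlying_space openin_underlying_space)

definition manifold_without_boundary :: "nat \<Rightarrow> 'a topology \<Rightarrow> bool" where
  "manifold_without_boundary d M \<longleftrightarrow>
    Hausdorff_space M \<and> second_countable M \<and>
    (\<forall>p\<in>topspace M. \<exists>U V. openin M U \<and> p \<in> U \<and> openin (Euclidean_space d) V \<and>
      subtopology M U homeomorphic_space subtopology (Euclidean_space d) V)"

text \<open>Every pure finite simplicial complex whose underlying space is a closed manifold is such a
  gluing, as links in it of faces of codimension at least two are connected.\<close>

definition triangulated_closed_manifold :: "nat \<Rightarrow> triangulation \<Rightarrow> bool" where
  "triangulated_closed_manifold d T \<longleftrightarrow>
    is_gluing d T \<and> compact_space (underlying_space d T) \<and>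
    manifold_without_boundary d (underlying_space d T)"


section \<open>Piecewise Riemannian metrics\<close>

definition tangent_space :: "nat \<Rightarrow> (nat \<Rightarrow> real) set" where
  "tangent_space d = {u. (\<forall>i>d. u i = 0) \<and> (\<Sum>i\<le>d. u i) = 0}"

text \<open>\<open>D ks\<close> is the iterated partial derivative of \<open>f\<close> with respect to the coordinates listed
  in \<open>ks\<close>.\<close>

definition smooth_on :: "(nat \<Rightarrow> real) set \<Rightarrow> ((nat \<Rightarrow> real) \<Rightarrow> real) \<Rightarrow> bool" where
  "smooth_on U f \<longleftrightarrow>
    (\<exists>D :: nat list \<Rightarrow> (nat \<Rightarrow> real) \<Rightarrow> real.
      (\<forall>x\<in>U. D [] x = f x) \<and>
      (\<forall>ks. continuous_on U (D ks) \<and>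
        (\<forall>i. \<forall>x\<in>U. ((\<lambda>h. D ks (x(i := h))) has_real_derivative D (i # ks) x) (at (x i)))))"

text \<open>\<open>g x u v\<close> is the inner product at the point \<open>x\<close> of the tangent vectors \<open>u\<close> and \<open>v\<close>. Smoothness
  on the closed simplex means existence of a smooth extension to an open neighbourhood.\<close>

definition riemannian_metric_on_simplex ::
  "nat \<Rightarrow> ((nat \<Rightarrow> real) \<Rightarrow> (nat \<Rightarrow> real) \<Rightarrow> (nat \<Rightarrow> real) \<Rightarrow> real) \<Rightarrow> bool" where
  "riemannian_metric_on_simplex d g \<longleftrightarrow>
    (\<forall>x\<in>standard_simplex d.
      (\<forall>u\<in>tangent_space d. \<forall>v\<in>tangent_space d. g x u v = g x v u) \<and>
      (\<forall>u\<in>tangent_space d. \<forall>v\<in>tangent_space d. \<forall>w\<in>tangent_space d. \<forall>a b.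
        g x (\<lambda>i. a * u i + b * v i) w = a * g x u w + b * g x v w) \<and>
      (\<forall>u\<in>tangent_space d. u \<noteq> (\<lambda>i. 0) \<longrightarrow> g x u u > 0)) \<and>
    (\<forall>u\<in>tangent_space d. \<forall>v\<in>tangent_space d.
      \<exists>U f. open U \<and> standard_simplex d \<subseteq> U \<and> smooth_on U f \<and>
        (\<forall>x\<in>standard_simplex d. f x = g x u v))"

type_synonym pw_metric = "nat \<Rightarrow> (nat \<Rightarrow> real) \<Rightarrow> (nat \<Rightarrow> real) \<Rightarrow> (nat \<Rightarrow> real) \<Rightarrow> real"

text \<open>The identifications between lower-dimensional faces are generated by those between facets,
  so compatibility on facets implies compatibility on all common faces.\<close>

definition piecewise_riemannian_metric :: "nat \<Rightarrow> triangulation \<Rightarrow> pw_metric \<Rightarrow> bool" where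
  "piecewise_riemannian_metric d T m \<longleftrightarrow>
    (\<forall>s<num_simplices T. riemannian_metric_on_simplex d (m s)) \<and>
    (\<forall>s<num_simplices T. \<forall>k\<le>d. \<forall>s' \<pi>. gluing T s k = Some (s', \<pi>) \<longrightarrow>
      (\<forall>x\<in>standard_simplex d. \<forall>u\<in>tangent_space d. \<forall>v\<in>tangent_space d.
        x k = 0 \<longrightarrow> u k = 0 \<longrightarrow> v k = 0 \<longrightarrow>
        m s' (x \<circ> inv_into UNIV \<pi>) (u \<circ> inv_into UNIV \<pi>) (v \<circ> inv_into UNIV \<pi>) = m s x u v))"

text \<open>The Riemannian volume is computed in the chart of the simplex given by the barycentric
  coordinates \<open>0, ..., d - 1\<close>, whose coordinate vector fields are the \<open>e\<^sub>i - e\<^sub>d\<close>.\<close>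

definition chart_point :: "nat \<Rightarrow> (nat \<Rightarrow> real) \<Rightarrow> nat \<Rightarrow> real" where
  "chart_point d y = (\<lambda>i. if i < d then y i else if i = d then 1 - (\<Sum>j<d. y j) else 0)"

definition chart_vector :: "nat \<Rightarrow> nat \<Rightarrow> nat \<Rightarrow> real" where
  "chart_vector d i = (\<lambda>j. (if j = i then 1 else 0) - (if j = d then 1 else 0))"

definition simplex_volume ::
  "nat \<Rightarrow> ((nat \<Rightarrow> real) \<Rightarrow> (nat \<Rightarrow> real) \<Rightarrow> (nat \<Rightarrow> real) \<Rightarrow> real) \<Rightarrow> ennreal" where
  "simplex_volume d g =
    (\<integral>\<^sup>+ y. ennreal (sqrt (Determinant.det (Matrix.mat d d
          (\<lambda>(i, j). g (chart_point d y) (chart_vector d i) (chart_vector d j)))))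
        * indicator {y. chart_point d y \<in> standard_simplex d} y
      \<partial>(\<Pi>\<^sub>M i\<in>{..<d}. lborel))"

definition volume :: "nat \<Rightarrow> triangulation \<Rightarrow> pw_metric \<Rightarrow> ennreal" where
  "volume d T m = (\<Sum>s<num_simplices T. simplex_volume d (m s))"


section \<open>Lengths of curves\<close>

text \<open>\<open>c\<close> is a \<open>C\<^sup>1\<close> curve in the simplex with velocity \<open>c'\<close>, parametrised by \<open>[0, 1]\<close>.\<close>

definition C1_curve_in_simplex ::
  "nat \<Rightarrow> (real \<Rightarrow> nat \<Rightarrow> real) \<Rightarrow> (real \<Rightarrow> nat \<Rightarrow> real) \<Rightarrow> bool" where
  "C1_curve_in_simplex d c c' \<longleftrightarrow>
    c ` {0..1} \<subseteq> standard_simplex d \<and> continuous_on {0..1} c' \<and>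
    (\<forall>t\<in>{0..1}. \<forall>i. ((\<lambda>t. c t i) has_real_derivative c' t i) (at t within {0..1}))"

definition C1_length ::
  "((nat \<Rightarrow> real) \<Rightarrow> (nat \<Rightarrow> real) \<Rightarrow> (nat \<Rightarrow> real) \<Rightarrow> real) \<Rightarrow>
    (real \<Rightarrow> nat \<Rightarrow> real) \<Rightarrow> (real \<Rightarrow> nat \<Rightarrow> real) \<Rightarrow> real" where
  "C1_length g c c' = integral {0..1} (\<lambda>t. sqrt (g (c t) (c' t) (c' t)))"

text \<open>There is a curve of length \<open>L\<close> from \<open>p\<close> to \<open>q\<close> that is a finite concatenation of \<open>C\<^sup>1\<close> curves,
  each of them within one simplex.\<close>

inductive joined_by_length ::
  "nat \<Rightarrow> triangulation \<Rightarrow> pw_metric \<Rightarrow> spoint set \<Rightarrow> spoint set \<Rightarrow> real \<Rightarrow> bool"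
  for d T m where
  const: "p \<in> topspace (underlying_space d T) \<Longrightarrow> joined_by_length d T m p p 0"
| append: "joined_by_length d T m p (point_class d T (s, c 0)) L \<Longrightarrow> s < num_simplices T \<Longrightarrow>
    C1_curve_in_simplex d c c' \<Longrightarrow>
    joined_by_length d T m p (point_class d T (s, c 1)) (L + C1_length (m s) c c')"

text \<open>The intrinsic distance (infinite between different components), and the length it induces
  on arbitrary continuous curves. Compatibility of the metric along common faces makes it agree
  with the sum of the \<^const>\<open>C1_length\<close>s for finite concatenations of \<open>C\<^sup>1\<close> curves in simplices.\<close>

definition metric_dist ::
  "nat \<Rightarrow> triangulation \<Rightarrow> pw_metric \<Rightarrow> spoint set \<Rightarrow> spoint set \<Rightarrow> ennreal" where
  "metric_dist d T m p q = Inf {ennreal L | L. joined_by_length d T m p q L}"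

definition curve_length ::
  "nat \<Rightarrow> triangulation \<Rightarrow> pw_metric \<Rightarrow> (real \<Rightarrow> spoint set) \<Rightarrow> ennreal" where
  "curve_length d T m \<gamma> =
    (SUP ts \<in> {ts. sorted ts \<and> set ts \<subseteq> {0..1}}.
      \<Sum>i<length ts - 1. metric_dist d T m (\<gamma> (ts ! i)) (\<gamma> (ts ! Suc i)))"


section \<open>Closed curves and the one-skeleton\<close>

definition closed_curve :: "'a topology \<Rightarrow> (real \<Rightarrow> 'a) \<Rightarrow> bool" where
  "closed_curve M \<gamma> \<longleftrightarrow> pathin M \<gamma> \<and> \<gamma> 1 = \<gamma> 0"

text \<open>Free homotopy of closed curves, as in \<^const>\<open>homotopic_loops\<close>.\<close>

definition homotopic_closed_curves ::
  "'a topology \<Rightarrow> (real \<Rightarrow> 'a) \<Rightarrow> (real \<Rightarrow> 'a) \<Rightarrow> bool" where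
  "homotopic_closed_curves M =
    homotopic_with (\<lambda>\<gamma>. \<gamma> 1 = \<gamma> 0) (top_of_set {0..1}) M"

definition simplex_vertex :: "nat \<Rightarrow> nat \<Rightarrow> real" where
  "simplex_vertex a = (\<lambda>i. if i = a then 1 else 0)"

definition edge_curve :: "nat \<Rightarrow> triangulation \<Rightarrow> nat \<Rightarrow> nat \<Rightarrow> nat \<Rightarrow> real \<Rightarrow> spoint set" where
  "edge_curve d T s a b =
    restrict (\<lambda>t. point_class d T (s, \<lambda>i. (1 - t) * simplex_vertex a i + t * simplex_vertex b i)) {0..1}"

text \<open>The arcs are the oriented edges in the underlying space, represented by their affine
  parametrisations; each edge thus yields an arc for either orientation, and identified edges
  yield the same arcs.\<close>

definition one_skeleton ::
  "nat \<Rightarrow> triangulation \<Rightarrow> (spoint set, real \<Rightarrow> spoint set) pre_digraph" where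
  "one_skeleton d T =
    \<lparr>verts = {point_class d T (s, simplex_vertex a) | s a. s < num_simplices T \<and> a \<le> d},
     arcs = {edge_curve d T s a b | s a b. s < num_simplices T \<and> a \<le> d \<and> b \<le> d \<and> a \<noteq> b},
     tail = (\<lambda>e. e 0),
     head = (\<lambda>e. e 1)\<rparr>"

text \<open>The closed curve \<open>\<gamma>\<close> runs through the closed walk with base vertex \<open>v\<close> and sequence of
  arcs \<open>w\<close>, each arc taking time \<open>1 / length w\<close>. It is constant if \<open>w\<close> is empty.\<close>

definition traverses_closed_walk ::
  "nat \<Rightarrow> triangulation \<Rightarrow> spoint set \<Rightarrow> (real \<Rightarrow> spoint set) list \<Rightarrow> (real \<Rightarrow> spoint set) \<Rightarrow> bool" where
  "traverses_closed_walk d T v w \<gamma> \<longleftrightarrow>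
    pre_digraph.awalk (one_skeleton d T) v w v \<and>
    (w = [] \<longrightarrow> (\<forall>t\<in>{0..1}. \<gamma> t = v)) \<and>
    (\<forall>j<length w. \<forall>\<tau>\<in>{0..1}. \<gamma> ((real j + \<tau>) / real (length w)) = (w ! j) \<tau>)"

end

theory Submission
  imports Defs
begin

text \<open>
  Every simplex receives the same multiple of the Euclidean metric in barycentric coordinates, scaled to
  volume one. It is invariant under permutations of the vertices and therefore compatible with every
  gluing (\<open>piecewise_riemannian_flat_metric\<close>, \<open>ex_flat_metric_unit_volume\<close>).

  Curves are compared with the one-skeleton by means of the open stars of the barycentric subdivision. A
  nonempty set of vertices of a simplex is dominant at a point if its coordinates exceed all others, and
  the star of a class of faces consists of the points at which a face of this class is dominant. Stars can
  be contracted, by straight lines, to the barycentre (\<open>contraction_cls\<close>, \<open>continuous_map_contraction\<close>), even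
  if different faces of one simplex are identified. At every point some face dominates by a margin depending
  only on \<open>d\<close> (\<open>ex_dominant_face\<close>), and as coordinates are Lipschitz functions of the length, a curve needs a
  length \<open>\<delta>\<close>, which depends only on \<open>d\<close>, to lose half of this margin (\<open>metric_dist_star\<close>). A curve of length
  \<open>L\<close> thus splits into \<open>N \<le> 1 + L / \<delta>\<close> pieces, each lying in one star (\<open>ex_short_star_chain\<close>).

  Contracting every piece inside its star yields a homotopic curve that runs from barycentre to barycentre.
  Between two consecutive barycentres it passes through a division point at which both faces are
  dominant, and lies in a single simplex (\<open>homotopic_to_barycentric_curve\<close>). Sliding every barycentre to a
  vertex of its face, compatibly with the identifications (\<open>ex_compatible_vertices\<close>), a straight-line
  homotopy in these simplices produces one edge, or a constant path, for each division point
  (\<open>homotopic_to_edge_pieces\<close>). Removing the constant paths leaves a closed walk with at most \<open>N\<close> arcs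
  (\<open>ex_closed_walk_of_edge_pieces\<close>). If \<open>N = 1\<close>, the only path is constant and the walk is empty; hence its
  length is always at most \<open>2 (N - 1) \<le> 2 L / \<delta>\<close>, and \<open>2 / \<delta>\<close> is the constant sought
  (\<open>ex_homotopic_closed_walk\<close>).
\<close>

section \<open>A flat metric of unit volume\<close>

text \<open>The matrices \<open>I + a J\<close>, with \<open>J\<close> the all-ones matrix, are closed under multiplication because
  \<open>J J = n J\<close>. This provides both an inverse and a square root of the Gram matrix \<open>I + J\<close>, so that its
  determinant is positive without having to be computed.\<close>

lemma identity_plus_constant_mat_mult:
  fixes a b :: real
  shows "mat n n (\<lambda>(i, j). (if i = j then 1 else 0) + a) * mat n n (\<lambda>(i, j). (if i = j then 1 else 0) + b) =
    mat n n (\<lambda>(i, j). (if i = j then 1 else 0) + (a + b + real n * a * b))" (is "?A * ?B = ?C")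
proof (rule eq_matI)
  fix i j assume "i < dim_row ?C" "j < dim_col ?C"
  then have ij: "i < n" "j < n" by auto
  have "(?A * ?B) $$ (i, j) = row ?A i \<bullet> col ?B j"
    using ij by (intro index_mult_mat) auto
  also have "\<dots> = (\<Sum>k<n. ((if i = k then 1 else 0) + a) * ((if k = j then 1 else 0) + b))"
    unfolding scalar_prod_def using ij by (intro sum.cong) auto
  also have "\<dots> = (\<Sum>k<n. (if k = i then (if i = j then 1 else 0) else 0) + (if k = i then b else 0)
      + (if k = j then a else 0) + a * b)"
    by (intro sum.cong) (auto simp: algebra_simps)
  also have "\<dots> = (if i = j then 1 else 0) + b + a + real n * (a * b)"
    using ij by (simp add: sum.distrib sum.delta)
  finally show "(?A * ?B) $$ (i, j) = ?C $$ (i, j)"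
    using ij by simp
qed auto

lemma det_identity_plus_ones_pos:
  "Determinant.det (mat n n (\<lambda>(i, j). (if i = j then 1 else 0) + (1::real))) > 0"
proof -
  define M where "M = (\<lambda>a::real. mat n n (\<lambda>(i, j). (if i = j then 1 else 0) + a))"
  have M [simp]: "M a \<in> carrier_mat n n" for a
    by (simp add: M_def)
  have mult: "M a * M b = M (a + b + real n * a * b)" for a b
    unfolding M_def by (rule identity_plus_constant_mat_mult)
  have M0: "M 0 = 1\<^sub>m n"
    unfolding M_def one_mat_def by (intro eq_matI) auto
  have "M 1 * M (- 1 / (real n + 1)) = M 0"
    unfolding mult by (rule arg_cong[of _ _ M]) (simp add: field_simps)
  then have "Determinant.det (M 1) * Determinant.det (M (- 1 / (real n + 1))) = 1"
    using M0 by (simp flip: det_mult[OF M M])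
  then have nz: "Determinant.det (M 1) \<noteq> 0" by auto
  \<comment> \<open>The coefficient \<open>1 / (1 + s)\<close> solves \<open>2 t + n t\<^sup>2 = 1\<close>, so it gives a square root of \<open>M 1\<close>.\<close>
  define s where "s = sqrt (1 + real n)"
  have s: "s * s = 1 + real n" "s \<ge> 0" by (simp_all add: s_def)
  have "1 / (1 + s) + 1 / (1 + s) + real n * (1 / (1 + s)) * (1 / (1 + s)) =
      (2 * (1 + s) + real n) / ((1 + s) * (1 + s))"
    using s(2) by (simp add: divide_simps)
  also have "2 * (1 + s) + real n = (1 + s) * (1 + s)"
    using s(1) by (simp add: algebra_simps)
  finally have "1 / (1 + s) + 1 / (1 + s) + real n * (1 / (1 + s)) * (1 / (1 + s)) = 1"
    using s(2) by simp
  then have "M (1 / (1 + s)) * M (1 / (1 + s)) = M 1"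
    unfolding mult by simp
  then have "Determinant.det (M 1) = Determinant.det (M (1 / (1 + s))) * Determinant.det (M (1 / (1 + s)))"
    using det_mult[OF M M] by metis
  then have "Determinant.det (M 1) > 0"
    using nz zero_le_square[of "Determinant.det (M (1 / (1 + s)))"] by linarith
  then show ?thesis
    by (simp add: M_def)
qed

text \<open>In barycentric coordinates the standard Euclidean inner product makes every simplex a regular one.
  Regularity makes the metric compatible with all identifications of facets, whatever permutation of
  the vertices they induce.\<close>

definition flat_metric :: "nat \<Rightarrow> real \<Rightarrow> pw_metric" where
  "flat_metric d \<kappa> s x u v = \<kappa> * (\<Sum>i\<le>d. u i * v i)"

lemma piecewise_riemannian_flat_metric:
  assumes "is_gluing d T" "\<kappa> > 0"
  shows "piecewise_riemannian_metric d T (flat_metric d \<kappa>)"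
proof -
  have const_smooth: "smooth_on UNIV (\<lambda>x. a)" for a
    unfolding smooth_on_def
    by (intro exI[of _ "\<lambda>ks x. if ks = [] then a else 0"]) auto
  have pos: "0 < (\<Sum>i\<le>d. u i * u i)" if u: "u \<in> tangent_space d" "u \<noteq> (\<lambda>i. 0)" for u
  proof -
    obtain i where i: "u i \<noteq> 0" using u(2) by auto
    with u(1) have "i \<le> d" unfolding tangent_space_def by (metis (mono_tags, lifting) mem_Collect_eq not_le)
    then have "u i * u i \<le> (\<Sum>i\<le>d. u i * u i)"
      by (intro member_le_sum) auto
    moreover have "0 < u i * u i" using i not_real_square_gt_zero by blast
    ultimately show ?thesis by linarith
  qed
  have "riemannian_metric_on_simplex d (flat_metric d \<kappa> s)" for s
    unfolding riemannian_metric_on_simplex_def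
  proof (intro conjI ballI allI impI)
    fix x u v w :: "nat \<Rightarrow> real" and a b :: real
    show "flat_metric d \<kappa> s x u v = flat_metric d \<kappa> s x v u"
      by (simp add: flat_metric_def mult.commute)
    show "flat_metric d \<kappa> s x (\<lambda>i. a * u i + b * v i) w = a * flat_metric d \<kappa> s x u w + b * flat_metric d \<kappa> s x v w"
      by (simp add: flat_metric_def algebra_simps sum.distrib sum_distrib_left)
    show "0 < flat_metric d \<kappa> s x u u" if "u \<in> tangent_space d" "u \<noteq> (\<lambda>i. 0)"
      unfolding flat_metric_def using pos[OF that] \<open>\<kappa> > 0\<close> by simp
    show "\<exists>U f. open U \<and> standard_simplex d \<subseteq> U \<and> smooth_on U f \<and> (\<forall>x\<in>standard_simplex d. f x = flat_metric d \<kappa> s x u v)"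
      by (intro exI[of _ UNIV] exI[of _ "\<lambda>x. \<kappa> * (\<Sum>i\<le>d. u i * v i)"])
        (auto simp: flat_metric_def const_smooth)
  qed
  moreover have "flat_metric d \<kappa> s' y (u \<circ> inv_into UNIV \<pi>) (v \<circ> inv_into UNIV \<pi>) = flat_metric d \<kappa> s x u v"
    if "\<pi> permutes {..d}" for s s' \<pi> x y u v
    using sum.permute[OF permutes_inv[OF that], of "\<lambda>i. u i * v i"]
    by (simp add: flat_metric_def o_def)
  ultimately show ?thesis
    using assms(1) unfolding piecewise_riemannian_metric_def is_gluing_def by blast
qed

text \<open>The Gram matrix of the chart vectors \<open>e\<^sub>i - e\<^sub>d\<close> is constant, equal to \<open>\<kappa> (I + J)\<close>, and the domain
  of the chart is the solid standard simplex of volume \<open>1 / d!\<close>.\<close>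

lemma simplex_volume_flat_metric:
  fixes d :: nat and \<kappa> :: real
  assumes "\<kappa> \<ge> 0"
  defines "D \<equiv> Determinant.det (mat d d (\<lambda>(i, j). (if i = j then 1 else 0) + (1::real)))"
  shows "simplex_volume d (flat_metric d \<kappa> s) = ennreal (sqrt (\<kappa> ^ d * D) / fact d)"
proof -
  have inner: "(\<Sum>k\<le>d. chart_vector d i k * chart_vector d j k) = (if i = j then 1 else 0) + 1"
    if "i < d" "j < d" for i j
  proof -
    have "(\<Sum>k\<le>d. chart_vector d i k * chart_vector d j k) =
        (\<Sum>k\<le>d. (if k = i then (if i = j then 1 else 0) else 0) + (if k = d then 1 else 0))"
      using that by (intro sum.cong) (auto simp: chart_vector_def)
    also have "\<dots> = (if i = j then 1 else 0) + 1"
      using that by (simp add: sum.distrib sum.delta)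
    finally show ?thesis .
  qed
  have gram: "mat d d (\<lambda>(i, j). flat_metric d \<kappa> s x (chart_vector d i) (chart_vector d j)) =
      \<kappa> \<cdot>\<^sub>m mat d d (\<lambda>(i, j). (if i = j then 1 else 0) + (1::real))" for x
    by (intro eq_matI) (auto simp: flat_metric_def inner)
  let ?S = "{x::nat \<Rightarrow> real. (\<forall>i\<in>{..<d}. 0 \<le> x i) \<and> sum x {..<d} \<le> 1}"
  let ?P = "\<Pi>\<^sub>M i\<in>{..<d}. (lborel :: real measure)"
  have chart: "chart_point d y \<in> standard_simplex d \<longleftrightarrow> y \<in> ?S" for y
  proof
    assume y: "chart_point d y \<in> standard_simplex d"
    have nonneg: "0 \<le> chart_point d y i" for i
      using y by (auto simp: standard_simplex_def)
    have "0 \<le> y i" if "i < d" for i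
      using that nonneg[of i] unfolding chart_point_def by (metis (full_types))
    moreover have "0 \<le> 1 - sum y {..<d}"
      using nonneg[of d] by (simp add: chart_point_def)
    ultimately show "y \<in> ?S"
      by simp
  next
    assume y: "y \<in> ?S"
    have "y i \<le> sum y {..<d}" if "i < d" for i
      using y that by (intro member_le_sum) auto
    moreover have "(\<Sum>i\<le>d. chart_point d y i) = 1"
    proof -
      have "(\<Sum>i\<le>d. chart_point d y i) = (\<Sum>i<d. chart_point d y i) + chart_point d y d"
        by (simp flip: lessThan_Suc_atMost)
      then show ?thesis by (simp add: chart_point_def)
    qed
    moreover have "0 \<le> sum y {..<d}"
      using y by (intro sum_nonneg) auto
    ultimately show "chart_point d y \<in> standard_simplex d"
      using y by (fastforce simp: standard_simplex_def chart_point_def)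
  qed
  have meas: "?S \<inter> space ?P \<in> sets ?P"
  proof -
    have "?S \<inter> space ?P = Pi\<^sub>E {..<d} (\<lambda>_. {0..}) \<inter> (\<lambda>x. sum x {..<d}) -` {..1} \<inter> space ?P"
      by (auto simp: space_PiM)
    also have "\<dots> \<in> sets ?P"
      by measurable
    finally show ?thesis .
  qed
  have "simplex_volume d (flat_metric d \<kappa> s) = (\<integral>\<^sup>+ y. ennreal (sqrt (\<kappa> ^ d * D)) * indicator (?S \<inter> space ?P) y \<partial>?P)"
    unfolding simplex_volume_def gram D_def
    by (intro nn_integral_cong) (auto simp: chart indicator_def det_smult)
  also have "\<dots> = ennreal (sqrt (\<kappa> ^ d * D)) * emeasure ?P (?S \<inter> space ?P)"
    by (rule nn_integral_cmult_indicator[OF meas])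
  also have "emeasure ?P (?S \<inter> space ?P) = ennreal (1 / fact d)"
    using emeasure_std_simplex_aux[of "{..<d}" 1] by simp
  finally show ?thesis
    using assms det_identity_plus_ones_pos[of d] by (simp flip: ennreal_mult)
qed

lemma ex_flat_metric_unit_volume:
  "\<exists>\<kappa>>0. \<forall>T. volume d T (flat_metric d \<kappa>) = of_nat (num_simplices T)"
proof -
  define D where "D = Determinant.det (mat d d (\<lambda>(i, j). (if i = j then 1 else 0) + (1::real)))"
  have D: "D > 0" unfolding D_def by (rule det_identity_plus_ones_pos)
  \<comment> \<open>For \<open>d = 0\<close> scaling has no effect, but a point already has volume one.\<close>
  obtain \<kappa> :: real where \<kappa>: "\<kappa> > 0" "\<kappa> ^ d * D = (fact d)\<^sup>2"
  proof (cases "d = 0")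
    case True
    then show ?thesis
      using that[of 1] by (simp add: D_def)
  next
    case False
    then show ?thesis
      using that[of "root d ((fact d)\<^sup>2 / D)"] D by (simp add: real_root_pow_pos)
  qed
  then have "simplex_volume d (flat_metric d \<kappa> s) = 1" for s
    using simplex_volume_flat_metric[of \<kappa> d s] by (simp flip: D_def)
  with \<kappa>(1) show ?thesis
    by (auto simp: volume_def)
qed

section \<open>Gluing and reparametrising closed curves\<close>

text \<open>Concatenation of \<open>N\<close> pieces, each taking time \<open>1 / N\<close>. The minimum assigns the end point \<open>t = 1\<close> to the
  last piece.\<close>

definition glue :: "nat \<Rightarrow> (nat \<Rightarrow> real \<Rightarrow> 'a) \<Rightarrow> real \<Rightarrow> 'a" where
  "glue N g t = (let j = min (N - 1) (nat \<lfloor>real N * t\<rfloor>) in g j (real N * t - real j))"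

lemma glue_eq:
  assumes "j < N" "\<tau> \<in> {0..1}" and match: "\<And>i. Suc i < N \<Longrightarrow> g i 1 = g (Suc i) 0"
  shows "glue N g ((real j + \<tau>) / real N) = g j \<tau>"
proof -
  have N: "real N * ((real j + \<tau>) / real N) = real j + \<tau>"
    using assms(1) by simp
  show ?thesis
  proof (cases "\<tau> = 1")
    case True
    then have fl: "nat \<lfloor>real j + \<tau>\<rfloor> = Suc j"
      by (simp add: nat_eq_iff)
    show ?thesis
    proof (cases "Suc j < N")
      case True
      then have "min (N - 1) (Suc j) = Suc j" by simp
      then show ?thesis
        unfolding glue_def N fl Let_def using match[OF True] \<open>\<tau> = 1\<close> by simp
    next
      case False
      then have "min (N - 1) (Suc j) = j" using assms(1) by simp
      then show ?thesis
        unfolding glue_def N fl Let_def by simp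
    qed
  next
    case False
    then have "\<lfloor>real j + \<tau>\<rfloor> = int j"
      using assms(2) by (simp add: floor_eq_iff)
    then have "nat \<lfloor>real j + \<tau>\<rfloor> = j" by simp
    moreover have "min (N - 1) j = j" using assms(1) by simp
    ultimately show ?thesis
      unfolding glue_def N Let_def by simp
  qed
qed

lemma glue_0: "N > 0 \<Longrightarrow> glue N g 0 = g 0 0"
  by (simp add: glue_def)

lemma glue_1: "N > 0 \<Longrightarrow> glue N g 1 = g (N - 1) 1"
  by (simp add: glue_def Let_def of_nat_diff)

lemma unit_interval_pieces:
  assumes "N > 0" "t \<in> {0..1}"
  obtains j \<tau> where "j < N" "\<tau> \<in> {0..1}" "t = (real j + \<tau>) / real N"
proof (cases "t = 1")
  case True
  then show ?thesis
    using that[of "N - 1" 1] assms by (simp add: of_nat_diff)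
next
  case False
  define j where "j = nat \<lfloor>real N * t\<rfloor>"
  have "real j = of_int \<lfloor>real N * t\<rfloor>"
    using assms by (simp add: j_def)
  then have j: "real j \<le> real N * t" "real N * t < real j + 1"
    by linarith+
  have "real N * t < real N"
    using assms False by simp
  then have "j < N" using j(1) by linarith
  moreover have "t = (real j + (real N * t - real j)) / real N"
    using assms(1) by simp
  ultimately show ?thesis
    using that[of j "real N * t - real j"] j by simp
qed

lemma continuous_map_glue:
  assumes cont: "\<And>j. j < N \<Longrightarrow> continuous_map (prod_topology X (top_of_set {0..1})) Z (\<lambda>(x, \<tau>). g x j \<tau>)"
    and match: "\<And>x j. x \<in> topspace X \<Longrightarrow> Suc j < N \<Longrightarrow> g x j 1 = g x (Suc j) 0"
    and "N > 0"
  shows "continuous_map (prod_topology X (top_of_set {0..1})) Z (\<lambda>(x, t). glue N (g x) t)"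
proof (rule pasting_lemma_closed[where I = "{..<N}"
      and T = "\<lambda>j. {z \<in> topspace (prod_topology X (top_of_set {0..1})). snd z \<in> {real j / N..(real j + 1) / N}}"
      and f = "\<lambda>j z. g (fst z) j (real N * snd z - real j)"])
  let ?P = "prod_topology X (top_of_set {0..1::real})"
  have snd: "continuous_map ?P euclideanreal snd"
    using continuous_map_snd continuous_map_into_fulltopology by blast
  fix j assume "j \<in> {..<N}"
  then have j: "j < N" by simp
  let ?T = "{z \<in> topspace ?P. snd z \<in> {real j / N..(real j + 1) / N}}"
  show "closedin ?P ?T"
    by (rule closedin_continuous_map_preimage[OF snd]) simp
  have "continuous_map (subtopology ?P ?T) ?P (\<lambda>z. (fst z, real N * snd z - real j))"
  proof (rule continuous_map_pairedI)
    show "continuous_map (subtopology ?P ?T) X fst"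
      by (intro continuous_map_from_subtopology continuous_map_fst)
    have "continuous_map (subtopology ?P ?T) euclideanreal (\<lambda>z. real N * snd z - real j)"
      by (intro continuous_intros continuous_map_from_subtopology snd) auto
    then show "continuous_map (subtopology ?P ?T) (top_of_set {0..1}) (\<lambda>z. real N * snd z - real j)"
      using \<open>N > 0\<close> by (auto simp: continuous_map_in_subtopology field_simps)
  qed
  from continuous_map_compose[OF this cont[OF j]]
  show "continuous_map (subtopology ?P ?T) Z (\<lambda>z. g (fst z) j (real N * snd z - real j))"
    by (simp add: o_def)
next
  have piece: "glue N (g x) t = g x j (real N * t - real j)"
    if "j < N" "x \<in> topspace X" "t \<in> {real j / N..(real j + 1) / N}" for x t j
  proof -
    have "real N * t - real j \<in> {0..1}"
      using that \<open>N > 0\<close> by (simp add: field_simps)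
    from glue_eq[OF that(1) this, of "g x"] match[OF that(2)] show ?thesis
      using \<open>N > 0\<close> by simp
  qed
  let ?P = "prod_topology X (top_of_set {0..1::real})"
  show "g (fst z) i (real N * snd z - real i) = g (fst z) j (real N * snd z - real j)"
    if "i \<in> {..<N}" "j \<in> {..<N}"
      "z \<in> topspace ?P \<inter> {z \<in> topspace ?P. snd z \<in> {real i / N..(real i + 1) / N}}
        \<inter> {z \<in> topspace ?P. snd z \<in> {real j / N..(real j + 1) / N}}" for i j z
    using piece[of i "fst z" "snd z"] piece[of j "fst z" "snd z"] that by auto
  show "\<exists>j. j \<in> {..<N} \<and> z \<in> {z \<in> topspace ?P. snd z \<in> {real j / N..(real j + 1) / N}} \<and>
      (case z of (x, t) \<Rightarrow> glue N (g x) t) = g (fst z) j (real N * snd z - real j)"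
    if z: "z \<in> topspace ?P" for z
  proof -
    have "snd z \<in> {0..1}" using z by auto
    then obtain j \<tau> where j: "j < N" "\<tau> \<in> {0..1}" "snd z = (real j + \<tau>) / real N"
      using unit_interval_pieces[OF \<open>N > 0\<close>] by blast
    then have "snd z \<in> {real j / N..(real j + 1) / N}"
      by (simp add: divide_right_mono)
    with j z show ?thesis
      using piece[of j "fst z" "snd z"] by (intro exI[of _ j]) (auto simp: mem_Times_iff split: prod.splits)
  qed
qed simp

lemma continuous_map_glue_path:
  assumes "\<And>j. j < N \<Longrightarrow> continuous_map (top_of_set {0..1}) Z (g j)"
    and "\<And>j. Suc j < N \<Longrightarrow> g j 1 = g (Suc j) 0" and "N > 0"
  shows "continuous_map (top_of_set {0..1}) Z (glue N g)"
proof -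
  let ?I = "top_of_set {0..1::real}"
  have "continuous_map (prod_topology ?I ?I) Z (\<lambda>(x, \<tau>). g j \<tau>)" if "j < N" for j
  proof -
    have eq: "(\<lambda>(x :: real, \<tau>). g j \<tau>) = g j \<circ> snd" by auto
    show ?thesis
      unfolding eq by (rule continuous_map_compose[OF continuous_map_snd assms(1)[OF that]])
  qed
  then have "continuous_map (prod_topology ?I ?I) Z (\<lambda>(x, t). glue N g t)"
    using assms(2,3) by (intro continuous_map_glue[where g = "\<lambda>_. g"]) auto
  moreover have "continuous_map ?I (prod_topology ?I ?I) (\<lambda>t. (0, t))"
    by (intro continuous_map_pairedI) auto
  ultimately have "continuous_map ?I Z ((\<lambda>(x :: real, t). glue N g t) \<circ> (\<lambda>t. (0, t)))"
    by (rule continuous_map_compose[rotated])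
  then show ?thesis by (simp add: o_def)
qed

lemma closed_curve_glue:
  assumes "\<And>j. j < N \<Longrightarrow> continuous_map (top_of_set {0..1}) Z (g j)"
    and "\<And>j. Suc j < N \<Longrightarrow> g j 1 = g (Suc j) 0" and "g (N - 1) 1 = g 0 0" and "N > 0"
  shows "closed_curve Z (glue N g)"
  unfolding closed_curve_def pathin_def
  using continuous_map_glue_path[of N Z g, OF assms(1,2,4)] assms(3,4) by (simp add: glue_0 glue_1)

lemma glue_cong:
  assumes "\<And>j \<tau>. j < N \<Longrightarrow> \<tau> \<in> {0..1} \<Longrightarrow> f ((real j + \<tau>) / real N) = g j \<tau>"
    and "\<And>j. Suc j < N \<Longrightarrow> g j 1 = g (Suc j) 0" and "N > 0" and t: "t \<in> {0..1}"
  shows "f t = glue N g t"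
proof -
  obtain j \<tau> where "j < N" "\<tau> \<in> {0..1}" "t = (real j + \<tau>) / real N"
    using unit_interval_pieces[OF \<open>N > 0\<close> t] .
  then show ?thesis
    using assms(1,2) glue_eq[of j N \<tau> g] by simp
qed

lemma homotopic_closed_curves_glue:
  fixes h :: "real \<Rightarrow> nat \<Rightarrow> real \<Rightarrow> 'a"
  assumes "\<And>j. j < N \<Longrightarrow> continuous_map (prod_topology (top_of_set {0..1}) (top_of_set {0..1})) Z (\<lambda>(\<sigma>, \<tau>). h \<sigma> j \<tau>)"
    and "\<And>\<sigma> j. \<sigma> \<in> {0..1} \<Longrightarrow> Suc j < N \<Longrightarrow> h \<sigma> j 1 = h \<sigma> (Suc j) 0"
    and "\<And>\<sigma>. \<sigma> \<in> {0..1} \<Longrightarrow> h \<sigma> (N - 1) 1 = h \<sigma> 0 0"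
    and "N > 0"
  shows "homotopic_closed_curves Z (glue N (h 0)) (glue N (h 1))"
proof -
  have "continuous_map (prod_topology (top_of_set {0..1}) (top_of_set {0..1})) Z (\<lambda>(\<sigma>, t). glue N (h \<sigma>) t)"
    by (rule continuous_map_glue) (use assms in auto)
  then show ?thesis
    unfolding homotopic_closed_curves_def homotopic_with_def
    using assms(3) by (intro exI[of _ "\<lambda>(\<sigma>, t). glue N (h \<sigma>) t"]) (auto simp: glue_0 glue_1 assms(4))
qed

lemma homotopic_closed_curves_trans:
  "homotopic_closed_curves Z \<alpha> \<beta> \<Longrightarrow> homotopic_closed_curves Z \<beta> \<gamma> \<Longrightarrow> homotopic_closed_curves Z \<alpha> \<gamma>"
  unfolding homotopic_closed_curves_def by (rule homotopic_with_trans)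

lemma homotopic_closed_curves_imp_closed_curve:
  assumes "homotopic_closed_curves Z \<alpha> \<beta>"
  shows "closed_curve Z \<alpha>" "closed_curve Z \<beta>"
  using homotopic_with_imp_continuous_maps[OF assms[unfolded homotopic_closed_curves_def]]
    homotopic_with_imp_property[OF assms[unfolded homotopic_closed_curves_def]]
  by (simp_all add: closed_curve_def pathin_def)

lemma homotopic_closed_curves_equal:
  assumes "closed_curve Z \<alpha>" "\<And>t. t \<in> {0..1} \<Longrightarrow> \<alpha> t = \<beta> t"
  shows "homotopic_closed_curves Z \<alpha> \<beta>"
  using assms unfolding homotopic_closed_curves_def closed_curve_def pathin_def
  by (intro homotopic_with_equal) auto

text \<open>The straight line between the identity and \<open>\<rho>\<close> stays in the unit interval and keeps both end points.\<close>

lemma homotopic_closed_curves_reparametrise: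
  assumes \<alpha>: "closed_curve Z \<alpha>" and \<rho>: "continuous_map (top_of_set {0..1}) (top_of_set {0..1}) \<rho>"
    and "\<rho> 0 = 0" "\<rho> 1 = 1"
  shows "homotopic_closed_curves Z \<alpha> (\<alpha> \<circ> \<rho>)"
proof -
  let ?I = "top_of_set {0..1::real}"
  let ?r = "\<lambda>z. (1 - fst z) * snd z + fst z * \<rho> (snd z)"
  have \<rho>_real: "continuous_map ?I euclideanreal \<rho>"
    using \<rho> continuous_map_into_fulltopology by blast
  have fst: "continuous_map (prod_topology ?I ?I) euclideanreal fst"
    and snd: "continuous_map (prod_topology ?I ?I) euclideanreal snd"
    and snd_I: "continuous_map (prod_topology ?I ?I) ?I snd"
    using continuous_map_fst continuous_map_snd continuous_map_into_fulltopology by blast+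
  have "continuous_map (prod_topology ?I ?I) euclideanreal ?r"
    using fst snd continuous_map_compose[OF snd_I \<rho>_real] by (intro continuous_intros) (auto simp: o_def)
  moreover have "?r (\<sigma>, t) \<in> {0..1}" if "\<sigma> \<in> {0..1}" "t \<in> {0..1}" for \<sigma> t
  proof -
    have "\<rho> t \<in> {0..1}"
      using continuous_map_funspace[OF \<rho>] that(2) by (simp add: Pi_iff)
    then have "0 \<le> \<rho> t" "\<rho> t \<le> 1" by simp_all
    with that have "0 \<le> (1 - \<sigma>) * t + \<sigma> * \<rho> t" "(1 - \<sigma>) * t + \<sigma> * \<rho> t \<le> 1"
      using convex_bound_le[of t 1 "\<rho> t" "1 - \<sigma>" \<sigma>] by simp_all
    then show ?thesis by simp
  qed
  ultimately have "continuous_map (prod_topology ?I ?I) ?I ?r"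
    by (simp add: continuous_map_in_subtopology Pi_iff)
  then have "continuous_map (prod_topology ?I ?I) Z (\<alpha> \<circ> ?r)"
    using \<alpha> unfolding closed_curve_def pathin_def by (blast intro: continuous_map_compose)
  then show ?thesis
    using \<alpha> assms(3,4) unfolding homotopic_closed_curves_def homotopic_with_def closed_curve_def
    by (intro exI[of _ "\<alpha> \<circ> ?r"]) auto
qed

section \<open>Faces of the simplices under the gluing\<close>

definition mix :: "(nat \<Rightarrow> real) \<Rightarrow> (nat \<Rightarrow> real) \<Rightarrow> real \<Rightarrow> nat \<Rightarrow> real" where
  "mix x y t = (\<lambda>i. (1 - t) * x i + t * y i)"

lemma mix_0 [simp]: "mix x y 0 = x" and mix_1 [simp]: "mix x y 1 = y"
  and mix_same [simp]: "mix x x t = x"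
  by (auto simp: mix_def algebra_simps)

lemma mix_comp: "mix x y t \<circ> f = mix (x \<circ> f) (y \<circ> f) t"
  by (auto simp: mix_def)

lemma mix_in_standard_simplex:
  assumes "x \<in> standard_simplex d" "y \<in> standard_simplex d" "t \<in> {0..1}"
  shows "mix x y t \<in> standard_simplex d"
  using assms unfolding mix_def by (intro convex_standard_simplex) auto

definition barycentre :: "nat set \<Rightarrow> nat \<Rightarrow> real" where
  "barycentre F = (\<lambda>i. if i \<in> F then 1 / real (card F) else 0)"

lemma barycentre_in_standard_simplex:
  assumes "F \<noteq> {}" "F \<subseteq> {..d}"
  shows "barycentre F \<in> standard_simplex d"
proof -
  have fin: "finite F" using assms(2) finite_subset by blast
  then have c: "card F > 0" using assms(1) by (simp add: card_gt_0_iff)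
  then have "1 / real (card F) \<le> 1" by simp
  moreover have "(\<Sum>i\<le>d. barycentre F i) = (\<Sum>i\<in>F. 1 / real (card F))"
    unfolding barycentre_def using assms(2) by (subst sum.inter_restrict[symmetric]) (auto simp: Int_absorb1)
  moreover have "(\<Sum>i\<in>F. 1 / real (card F)) = 1"
    using c by simp
  moreover have "0 \<le> barycentre F i" "i > d \<Longrightarrow> barycentre F i = 0" for i
    using assms(2) by (auto simp: barycentre_def)
  moreover have "barycentre F i \<le> 1" for i
    using \<open>1 / real (card F) \<le> 1\<close> by (simp add: barycentre_def)
  ultimately show ?thesis
    by (simp add: standard_simplex_def)
qed

lemma simplex_vertex_in_standard_simplex:
  assumes "a \<le> d"
  shows "simplex_vertex a \<in> standard_simplex d"
  using assms unfolding simplex_vertex_def by simp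

lemma barycentre_eq_0_iff: "finite F \<Longrightarrow> barycentre F i = 0 \<longleftrightarrow> i \<notin> F"
  by (auto simp: barycentre_def)

lemma barycentre_comp_inv:
  assumes "\<pi> permutes S"
  shows "barycentre F \<circ> inv_into UNIV \<pi> = barycentre (\<pi> ` F)"
proof -
  have "inv_into UNIV \<pi> i \<in> F \<longleftrightarrow> i \<in> \<pi> ` F" for i
    using permutes_inverses[OF assms] by (metis image_iff)
  moreover have "card (\<pi> ` F) = card F"
    using permutes_inj[OF assms] by (simp add: card_image inj_on_subset)
  ultimately show ?thesis
    by (auto simp: barycentre_def)
qed

lemma simplex_vertex_comp_inv:
  assumes "\<pi> permutes S"
  shows "simplex_vertex a \<circ> inv_into UNIV \<pi> = simplex_vertex (\<pi> a)"
  using permutes_inverses[OF assms] by (auto simp: simplex_vertex_def fun_eq_iff)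

lemma standard_simplex_comp_permutation:
  assumes "x \<in> standard_simplex d" "\<pi> permutes {..d}"
  shows "x \<circ> \<pi> \<in> standard_simplex d"
proof -
  have "(\<Sum>i\<le>d. x (\<pi> i)) = (\<Sum>i\<le>d. x i)"
    using sum.permute[OF assms(2), of x] by (simp add: o_def)
  then show ?thesis
    using assms permutes_not_in[OF assms(2)] by (auto simp: standard_simplex_def)
qed

lemma point_class_eq_iff:
  "point_class d T p = point_class d T q \<longleftrightarrow> (p, q) \<in> gluing_rel d T"
proof -
  have "sym (gluing_rel d T)" "trans (gluing_rel d T)" "refl (gluing_rel d T)"
    unfolding gluing_rel_def by (auto intro!: sym_rtrancl sym_Un_converse trans_rtrancl refl_rtrancl)
  then have "equiv UNIV (gluing_rel d T)"
    by (simp add: equiv_def)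
  then show ?thesis
    unfolding point_class_def by (simp add: eq_equiv_class_iff)
qed

text \<open>An identification of two points extends to the whole face spanned by the support of the first one:
  each facet identification in the chain is affine and applies to all points whose vanishing
  coordinates include those of the given point. Together with its being an equivalence, this is all
  that the remaining arguments use about the gluing relation.\<close>

lemma gluing_rel_transport:
  assumes T: "is_gluing d T" and rel: "((s, x), q) \<in> gluing_rel d T"
    and s: "s < num_simplices T" and x: "x \<in> standard_simplex d"
  shows "\<exists>s' \<pi>. q = (s', x \<circ> inv_into UNIV \<pi>) \<and> s' < num_simplices T \<and> \<pi> permutes {..d} \<and>
    (\<forall>y\<in>standard_simplex d. (\<forall>i. x i = 0 \<longrightarrow> y i = 0) \<longrightarrow>
      ((s, y), (s', y \<circ> inv_into UNIV \<pi>)) \<in> gluing_rel d T)"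
  using rel unfolding gluing_rel_def
proof (induction rule: rtrancl_induct)
  case base
  have "id permutes {..d}" "y \<circ> inv_into UNIV id = y" for y :: "nat \<Rightarrow> real"
    by (rule permutes_id) simp
  then show ?case
    using s by (metis rtrancl.rtrancl_refl)
next
  case (step p q)
  let ?R = "facet_identification d T \<union> (facet_identification d T)\<inverse>"
  obtain s1 \<pi>1 where p: "p = (s1, x \<circ> inv_into UNIV \<pi>1)" "s1 < num_simplices T" and \<pi>1: "\<pi>1 permutes {..d}"
    and tr1: "\<And>y. y \<in> standard_simplex d \<Longrightarrow> (\<forall>i. x i = 0 \<longrightarrow> y i = 0) \<Longrightarrow>
      ((s, y), (s1, y \<circ> inv_into UNIV \<pi>1)) \<in> ?R\<^sup>*"
    using step.IH by blast
  \<comment> \<open>A step may traverse a facet identification in either direction; backwards it acts by the inverse permutation.\<close>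
  obtain s2 \<pi>2 where q: "q = (s2, x \<circ> inv_into UNIV \<pi>1 \<circ> inv_into UNIV \<pi>2)" "s2 < num_simplices T" and \<pi>2: "\<pi>2 permutes {..d}"
    and tr2: "\<And>y. y \<in> standard_simplex d \<Longrightarrow> (\<forall>i. (x \<circ> inv_into UNIV \<pi>1) i = 0 \<longrightarrow> y i = 0) \<Longrightarrow>
      ((s1, y), (s2, y \<circ> inv_into UNIV \<pi>2)) \<in> ?R"
  proof (cases "(p, q) \<in> facet_identification d T")
    case True
    then obtain s2 \<pi> k where k: "q = (s2, x \<circ> inv_into UNIV \<pi>1 \<circ> inv_into UNIV \<pi>)" "k \<le> d" "(x \<circ> inv_into UNIV \<pi>1) k = 0"
      "gluing T s1 k = Some (s2, \<pi>)"
      unfolding facet_identification_def p by auto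
    moreover have "s2 < num_simplices T" "\<pi> permutes {..d}"
      using T k(2,4) p(2) unfolding is_gluing_def by blast+
    ultimately show ?thesis
      using that[of s2 \<pi>] p(2) unfolding facet_identification_def by blast
  next
    case False
    then have "(q, p) \<in> facet_identification d T"
      using step.hyps by auto
    then obtain s2 x2 \<pi> k where k: "q = (s2, x2)" "s2 < num_simplices T" "x2 \<in> standard_simplex d"
      "x \<circ> inv_into UNIV \<pi>1 = x2 \<circ> inv_into UNIV \<pi>" "k \<le> d" "x2 k = 0" "gluing T s2 k = Some (s1, \<pi>)"
      unfolding facet_identification_def p by auto
    then have \<pi>: "\<pi> permutes {..d}"
      using T unfolding is_gluing_def by blast
    then have inv: "inv_into UNIV (inv_into UNIV \<pi>) = \<pi>" "inv_into UNIV \<pi> \<circ> \<pi> = id" "\<pi> \<circ> inv_into UNIV \<pi> = id"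
      by (simp_all add: permutes_inv_inv permutes_inv_o)
    have "((s1, y), (s2, y \<circ> inv_into UNIV (inv_into UNIV \<pi>))) \<in> ?R"
      if y: "y \<in> standard_simplex d" "\<forall>i. (x \<circ> inv_into UNIV \<pi>1) i = 0 \<longrightarrow> y i = 0" for y
    proof -
      have "y = (y \<circ> \<pi>) \<circ> inv_into UNIV \<pi>"
        by (simp only: comp_assoc inv(3) comp_id)
      moreover have "(y \<circ> \<pi>) k = 0"
        using y(2) k(6) unfolding k(4) by (simp add: permutes_inverses[OF \<pi>])
      moreover have "y \<circ> \<pi> \<in> standard_simplex d"
        using y(1) \<pi> by (rule standard_simplex_comp_permutation)
      ultimately have "((s2, y \<circ> \<pi>), (s1, y)) \<in> facet_identification d T"
        unfolding facet_identification_def using k(2,5,7) by blast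
      then show ?thesis
        by (simp add: inv(1))
    qed
    moreover have "x2 = x \<circ> inv_into UNIV \<pi>1 \<circ> inv_into UNIV (inv_into UNIV \<pi>)"
      by (simp only: k(4) inv(1) comp_assoc inv(2) comp_id)
    ultimately show ?thesis
      using that[of s2 "inv_into UNIV \<pi>"] k(1,2) permutes_inv[OF \<pi>] by blast
  qed
  have inv: "inv_into UNIV (\<pi>2 \<circ> \<pi>1) = inv_into UNIV \<pi>1 \<circ> inv_into UNIV \<pi>2"
    using \<pi>1 \<pi>2 by (simp add: o_inv_distrib permutes_bij)
  show ?case
  proof (intro exI[of _ s2] exI[of _ "\<pi>2 \<circ> \<pi>1"] conjI ballI impI)
    show "q = (s2, x \<circ> inv_into UNIV (\<pi>2 \<circ> \<pi>1))"
      by (simp only: q(1) inv comp_assoc)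
    show "\<pi>2 \<circ> \<pi>1 permutes {..d}"
      using \<pi>1 \<pi>2 by (rule permutes_compose)
    fix y assume y: "y \<in> standard_simplex d" "\<forall>i. x i = 0 \<longrightarrow> y i = 0"
    then have "((s1, y \<circ> inv_into UNIV \<pi>1), (s2, y \<circ> inv_into UNIV \<pi>1 \<circ> inv_into UNIV \<pi>2)) \<in> ?R"
      by (intro tr2 standard_simplex_comp_permutation permutes_inv[OF \<pi>1]) auto
    with tr1[OF y] show "((s, y), (s2, y \<circ> inv_into UNIV (\<pi>2 \<circ> \<pi>1))) \<in> ?R\<^sup>*"
      unfolding inv comp_assoc by (rule rtrancl.rtrancl_into_rtrancl)
  qed (rule q(2))
qed

lemma point_class_transport:
  assumes "is_gluing d T" "point_class d T (s, x) = point_class d T (s', x')"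
    and "s < num_simplices T" "x \<in> standard_simplex d"
  obtains \<pi> where "\<pi> permutes {..d}" "x' = x \<circ> inv_into UNIV \<pi>"
    "\<And>y. y \<in> standard_simplex d \<Longrightarrow> (\<And>i. x i = 0 \<Longrightarrow> y i = 0) \<Longrightarrow>
      point_class d T (s', y \<circ> inv_into UNIV \<pi>) = point_class d T (s, y)"
proof -
  have "((s, x), (s', x')) \<in> gluing_rel d T"
    using assms(2) by (simp add: point_class_eq_iff)
  from gluing_rel_transport[OF assms(1) this assms(3,4)] obtain \<pi> where \<pi>: "\<pi> permutes {..d}"
    "x' = x \<circ> inv_into UNIV \<pi>"
    and tr: "\<forall>y\<in>standard_simplex d. (\<forall>i. x i = 0 \<longrightarrow> y i = 0) \<longrightarrow>
      ((s, y), (s', y \<circ> inv_into UNIV \<pi>)) \<in> gluing_rel d T"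
    by blast
  have "point_class d T (s', y \<circ> inv_into UNIV \<pi>) = point_class d T (s, y)"
    if "y \<in> standard_simplex d" "\<And>i. x i = 0 \<Longrightarrow> y i = 0" for y
    using tr that by (metis point_class_eq_iff)
  with \<pi> show ?thesis
    by (rule that)
qed

section \<open>Open stars of faces and their contractions\<close>

text \<open>The differences \<open>x i - x j\<close> are required to lie in a parameter set \<open>R\<close>, so that the same notion
  serves for strict dominance (\<open>R = {0<..}\<close>), which is an open condition, and for dominance with a
  margin \<open>\<theta>\<close> (\<open>R = {\<theta>..}\<close>), which is a closed one. The index \<open>j\<close> ranges over all natural numbers: since
  coordinates beyond \<open>d\<close> vanish, this forces the coordinates in \<open>F\<close> to be positive, even for \<open>F = {..d}\<close>.
  Strict dominance of \<open>F\<close> says that, in the barycentric subdivision, the coordinate of \<open>x\<close> at the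
  barycentre of \<open>F\<close> is positive.\<close>

definition dominant :: "nat \<Rightarrow> real set \<Rightarrow> nat set \<Rightarrow> (nat \<Rightarrow> real) \<Rightarrow> bool" where
  "dominant d R F x \<longleftrightarrow> F \<noteq> {} \<and> F \<subseteq> {..d} \<and> (\<forall>i\<in>F. \<forall>j. j \<notin> F \<longrightarrow> x i - x j \<in> R)"

lemma dominant_mono: "dominant d R F x \<Longrightarrow> R \<subseteq> R' \<Longrightarrow> dominant d R' F x"
  by (auto simp: dominant_def)

lemma dominant_subset: "dominant d R F x \<Longrightarrow> F \<subseteq> {..d}"
  by (simp add: dominant_def)

lemma dominant_barycentre:
  assumes "dominant d R F x"
  shows "barycentre F \<in> standard_simplex d"
  using assms barycentre_in_standard_simplex by (auto simp: dominant_def)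

lemma dominant_finite:
  assumes "dominant d R F x"
  shows "finite F"
  using assms finite_subset[of F "{..d}"] by (auto simp: dominant_def)

lemma dominant_pos:
  assumes "dominant d {0<..} F x" "x \<in> standard_simplex d" "i \<in> F"
  shows "x i > 0"
proof -
  have "Suc d \<notin> F" using assms(1) by (auto simp: dominant_def)
  then have "x i - x (Suc d) > 0"
    using assms(1,3) by (auto simp: dominant_def)
  with assms(2) show ?thesis
    by (simp add: standard_simplex_def)
qed

lemma dominant_supports_barycentre:
  assumes "dominant d {0<..} F x" "x \<in> standard_simplex d" "x i = 0"
  shows "barycentre F i = 0"
  using dominant_pos[OF assms(1,2), of i] assms(3) by (auto simp: barycentre_def)

lemma dominant_permute:
  assumes "dominant d R F x" "\<pi> permutes {..d}"
  shows "dominant d R (\<pi> ` F) (x \<circ> inv_into UNIV \<pi>)"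
  unfolding dominant_def
proof (intro conjI ballI allI impI)
  show "\<pi> ` F \<noteq> {}" using assms(1) by (simp add: dominant_def)
  show "\<pi> ` F \<subseteq> {..d}"
    using assms permutes_image[OF assms(2)] unfolding dominant_def by blast
  fix i j assume "i \<in> \<pi> ` F" "j \<notin> \<pi> ` F"
  then have "inv_into UNIV \<pi> i \<in> F" "inv_into UNIV \<pi> j \<notin> F"
    using permutes_inverses[OF assms(2)] by (metis image_iff)+
  then show "(x \<circ> inv_into UNIV \<pi>) i - (x \<circ> inv_into UNIV \<pi>) j \<in> R"
    using assms(1) by (simp add: dominant_def)
qed

text \<open>The faces that are dominant at a point form a chain, namely the flag of the simplex of the barycentric
  subdivision containing it, so each dimension occurs at most once.\<close>

lemma dominant_unique:
  assumes F: "dominant d {0<..} F x" and G: "dominant d {0<..} G x" and "card F = card G"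
  shows "F = G"
proof -
  have "F \<subseteq> G \<or> G \<subseteq> F"
  proof (rule ccontr)
    assume "\<not> ?thesis"
    then obtain i j where "i \<in> F" "i \<notin> G" "j \<in> G" "j \<notin> F" by blast
    then have "x i - x j \<in> {0<..}" "x j - x i \<in> {0<..}"
      using F G by (auto simp: dominant_def)
    then show False by simp
  qed
  then show ?thesis
    using dominant_finite[OF F] dominant_finite[OF G] assms(3) card_subset_eq by metis
qed

locale glued_simplices =
  fixes d :: nat and T :: triangulation
  assumes gluing: "is_gluing d T"
begin

abbreviation M :: "spoint set topology" where "M \<equiv> underlying_space d T"

abbreviation cls :: "nat \<Rightarrow> (nat \<Rightarrow> real) \<Rightarrow> spoint set" where "cls s x \<equiv> point_class d T (s, x)"

lemma cls_in_topspace: "s < num_simplices T \<Longrightarrow> x \<in> standard_simplex d \<Longrightarrow> cls s x \<in> topspace M"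
  by (auto simp: topspace_underlying_space simplices_points_def)

lemma topspace_M_cases:
  assumes "p \<in> topspace M"
  obtains s x where "p = cls s x" "s < num_simplices T" "x \<in> standard_simplex d"
  using assms by (auto simp: topspace_underlying_space simplices_points_def)

lemmas transport = point_class_transport[OF gluing]

text \<open>A class of faces is represented by the point of the underlying space at which their barycentres
  lie; the dimension of the face can be read off from this point.\<close>

lemma barycentre_cls_card:
  assumes eq: "cls s (barycentre F) = cls s' (barycentre G)" and s: "s < num_simplices T"
    and F: "F \<noteq> {}" "F \<subseteq> {..d}" and G: "G \<subseteq> {..d}"
  shows "card F = card G"
proof -
  obtain \<pi> where \<pi>: "\<pi> permutes {..d}" "barycentre G = barycentre F \<circ> inv_into UNIV \<pi>"
    using transport[OF eq s barycentre_in_standard_simplex[OF F]] by metis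
  have fin: "finite F" "finite G" using F G finite_subset by blast+
  have "barycentre G = barycentre (\<pi> ` F)"
    using \<pi> barycentre_comp_inv by metis
  then have "i \<in> G \<longleftrightarrow> i \<in> \<pi> ` F" for i
    using barycentre_eq_0_iff[OF fin(2)] barycentre_eq_0_iff[of "\<pi> ` F"] fin by (metis finite_imageI)
  then have "G = \<pi> ` F" by blast
  then show ?thesis
    using permutes_inj[OF \<pi>(1)] by (simp add: card_image inj_on_subset)
qed

text \<open>For \<open>R = {0<..}\<close> and \<open>c\<close> the barycentre of a face, this is the open star of \<open>c\<close> in the barycentric
  subdivision. In contrast to stars of vertices of the original simplices it does not meet itself when
  faces of one simplex are identified with each other, which is what makes it contractible.\<close>

definition star :: "real set \<Rightarrow> spoint set \<Rightarrow> spoint set set" where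
  "star R c = {p. \<exists>s x F. p = cls s x \<and> s < num_simplices T \<and> x \<in> standard_simplex d \<and>
    dominant d R F x \<and> cls s (barycentre F) = c}"

lemma star_mono: "R \<subseteq> R' \<Longrightarrow> star R c \<subseteq> star R' c"
  unfolding star_def using dominant_mono[of d R _ _ R']
  by (intro subsetI CollectI; elim CollectE exE conjE; intro exI conjI; assumption?; simp)

lemma star_subset: "star R c \<subseteq> topspace M"
  by (auto simp: star_def intro: cls_in_topspace)

lemma starI:
  "s < num_simplices T \<Longrightarrow> x \<in> standard_simplex d \<Longrightarrow> dominant d R F x \<Longrightarrow>
    cls s x \<in> star R (cls s (barycentre F))"
  unfolding star_def by blast

text \<open>Whether a point belongs to a star can be tested on any of its representatives, since the dominant
  face moves along with the point: it is contained in the support.\<close>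

lemma star_representative:
  assumes p: "cls s x \<in> star R c" and s: "s < num_simplices T" and x: "x \<in> standard_simplex d"
    and R: "R \<subseteq> {0<..}"
  obtains F where "dominant d R F x" "cls s (barycentre F) = c"
proof -
  obtain s0 x0 F where F: "cls s0 x0 = cls s x" "s0 < num_simplices T" "x0 \<in> standard_simplex d"
    "dominant d R F x0" "cls s0 (barycentre F) = c"
    using p unfolding star_def by auto
  from transport[OF F(1-3)] obtain \<pi> where \<pi>: "\<pi> permutes {..d}" "x = x0 \<circ> inv_into UNIV \<pi>"
    and tr: "\<And>y. y \<in> standard_simplex d \<Longrightarrow> (\<And>i. x0 i = 0 \<Longrightarrow> y i = 0) \<Longrightarrow>
      cls s (y \<circ> inv_into UNIV \<pi>) = cls s0 y"
    by blast
  have "cls s (barycentre F \<circ> inv_into UNIV \<pi>) = c"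
    using tr[OF dominant_barycentre[OF F(4)]]
      dominant_supports_barycentre[OF dominant_mono[OF F(4) R] F(3)] F(5) by metis
  then show ?thesis
    using that[of "\<pi> ` F"] dominant_permute[OF F(4) \<pi>(1)] \<pi> barycentre_comp_inv[OF \<pi>(1)] by simp
qed

text \<open>Straight-line motion to the barycentre of the dominant face, expressed on classes of points.\<close>

definition contraction :: "spoint set \<Rightarrow> real \<Rightarrow> spoint set \<Rightarrow> spoint set" where
  "contraction c t p = (SOME q. \<exists>s x F. p = cls s x \<and> s < num_simplices T \<and> x \<in> standard_simplex d \<and>
    dominant d {0<..} F x \<and> cls s (barycentre F) = c \<and> q = cls s (mix x (barycentre F) t))"

text \<open>Independence of the representative: dominant faces of two representatives in the class \<open>c\<close> correspond
  under the permutation relating the representatives, because they have the same cardinality.\<close>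

lemma contraction_cls:
  assumes s: "s < num_simplices T" and x: "x \<in> standard_simplex d"
    and F: "dominant d {0<..} F x" and t: "t \<in> {0..1}"
  shows "contraction (cls s (barycentre F)) t (cls s x) = cls s (mix x (barycentre F) t)"
proof -
  have "cls s' (mix x' (barycentre F') t) = cls s (mix x (barycentre F) t)"
    if eq: "cls s' x' = cls s x" and s': "s' < num_simplices T" and x': "x' \<in> standard_simplex d"
      and F': "dominant d {0<..} F' x'" and c: "cls s' (barycentre F') = cls s (barycentre F)"
    for s' x' F'
  proof -
    obtain \<pi> where \<pi>: "\<pi> permutes {..d}" "x = x' \<circ> inv_into UNIV \<pi>"
      and tr: "\<And>y. y \<in> standard_simplex d \<Longrightarrow> (\<And>i. x' i = 0 \<Longrightarrow> y i = 0) \<Longrightarrow>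
        cls s (y \<circ> inv_into UNIV \<pi>) = cls s' y"
      using transport[OF eq s' x'] by blast
    have b: "barycentre F' \<in> standard_simplex d"
      using F' by (rule dominant_barycentre)
    have dom: "dominant d {0<..} (\<pi> ` F') x"
      using dominant_permute[OF F' \<pi>(1)] \<pi>(2) by simp
    have "cls s' (barycentre F') = cls s (barycentre (\<pi> ` F'))"
      using tr[OF b] dominant_supports_barycentre[OF F' x'] barycentre_comp_inv[OF \<pi>(1)] by metis
    then have "card (\<pi> ` F') = card F"
      using c dom F by (intro barycentre_cls_card[of s _ s]) (auto simp: s dominant_def)
    then have "\<pi> ` F' = F"
      using dominant_unique[OF dom F] by simp
    then have "barycentre F' \<circ> inv_into UNIV \<pi> = barycentre F"
      using barycentre_comp_inv[OF \<pi>(1)] by metis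
    moreover have "mix x' (barycentre F') t i = 0" if "x' i = 0" for i
      using that dominant_supports_barycentre[OF F' x' that] by (simp add: mix_def)
    ultimately show ?thesis
      using tr[OF mix_in_standard_simplex[OF x' b t]] \<pi>(2) by (simp add: mix_comp)
  qed
  then show ?thesis
    unfolding contraction_def using assms by (intro some_equality) (blast, metis)
qed

lemma continuous_map_cls:
  assumes s: "continuous_map X (discrete_topology {..<num_simplices T}) s"
    and "\<And>i. continuous_map X euclideanreal (\<lambda>z. f z i)"
    and "f \<in> topspace X \<rightarrow> standard_simplex d"
  shows "continuous_map X M (\<lambda>z. cls (s z) (f z))"
proof -
  have "continuous_map X (powertop_real UNIV) f"
    using assms(2) by (simp add: continuous_map_componentwise_UNIV)
  then have "continuous_map X (simplices_topology d T) (\<lambda>z. (s z, f z))"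
    unfolding simplices_topology_def using s assms(3)
    by (simp add: continuous_map_pairedI continuous_map_in_subtopology euclidean_product_topology)
  then have "continuous_map X M (point_class d T \<circ> (\<lambda>z. (s z, f z)))"
    by (rule continuous_map_compose) (rule quotient_imp_continuous_map[OF quotient_map_point_class])
  then show ?thesis by (simp add: o_def)
qed

lemma continuous_map_cls_const:
  assumes "s < num_simplices T" "\<And>i. continuous_map X euclideanreal (\<lambda>z. f z i)"
    and "f \<in> topspace X \<rightarrow> standard_simplex d"
  shows "continuous_map X M (\<lambda>z. cls s (f z))"
  using assms by (intro continuous_map_cls) auto

abbreviation Y :: "spoint topology" where "Y \<equiv> simplices_topology d T"

lemma continuous_map_index: "continuous_map Y (discrete_topology {..<num_simplices T}) fst"
  unfolding simplices_topology_def by (rule continuous_map_fst)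

lemma continuous_map_coordinate: "continuous_map Y euclideanreal (\<lambda>p. snd p i)"
proof -
  have "continuous_map Y (top_of_set (standard_simplex d)) snd"
    unfolding simplices_topology_def by (rule continuous_map_snd)
  then have "continuous_map Y (powertop_real UNIV) snd"
    by (simp add: continuous_map_in_subtopology euclidean_product_topology)
  then show ?thesis
    by (simp add: continuous_map_componentwise_UNIV)
qed

lemma finite_Ball_openin_closedin:
  assumes "finite K"
  shows "(\<And>k. k \<in> K \<Longrightarrow> openin X {p \<in> topspace X. Q k p}) \<Longrightarrow> openin X {p \<in> topspace X. \<forall>k\<in>K. Q k p}"
    and "(\<And>k. k \<in> K \<Longrightarrow> closedin X {p \<in> topspace X. Q k p}) \<Longrightarrow> closedin X {p \<in> topspace X. \<forall>k\<in>K. Q k p}"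
proof -
  have eq: "{p \<in> topspace X. \<forall>k\<in>K. Q k p} = \<Inter> (insert (topspace X) ((\<lambda>k. {p \<in> topspace X. Q k p}) ` K))"
    by auto
  show "openin X {p \<in> topspace X. \<forall>k\<in>K. Q k p}" if "\<And>k. k \<in> K \<Longrightarrow> openin X {p \<in> topspace X. Q k p}"
    unfolding eq using that assms by (intro openin_Inter) auto
  show "closedin X {p \<in> topspace X. \<forall>k\<in>K. Q k p}" if "\<And>k. k \<in> K \<Longrightarrow> closedin X {p \<in> topspace X. Q k p}"
    unfolding eq using that by (intro closedin_Inter) auto
qed

text \<open>The preimage of a star in the disjoint union of the simplices falls into the pieces on which the
  dominant face is constant.\<close>

definition face_piece :: "real set \<Rightarrow> spoint set \<Rightarrow> nat set \<Rightarrow> spoint set" where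
  "face_piece R c F = {p \<in> topspace Y. dominant d R F (snd p) \<and> cls (fst p) (barycentre F) = c}"

lemma face_piece_open_closed:
  shows "open R \<Longrightarrow> openin Y (face_piece R c F)"
    and "closed R \<Longrightarrow> closedin Y (face_piece R c F)"
proof -
  \<comment> \<open>One vanishing coordinate, the one at \<open>Suc d\<close>, stands for all those beyond \<open>d\<close>.\<close>
  let ?K = "F \<times> ({..Suc d} - F)"
  let ?A = "{p \<in> topspace Y. fst p \<in> {s \<in> {..<num_simplices T}. cls s (barycentre F) = c}}"
  let ?B = "{p \<in> topspace Y. \<forall>k\<in>?K. snd p (fst k) - snd p (snd k) \<in> R}"
  have eq: "face_piece R c F = (if F \<noteq> {} \<and> F \<subseteq> {..d} then ?A \<inter> ?B else {})" (is "_ = ?rhs")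
  proof (intro Set.set_eqI iffI)
    fix p assume "p \<in> face_piece R c F"
    then show "p \<in> ?rhs"
      by (auto simp: face_piece_def dominant_def simplices_points_def)
  next
    fix p assume p: "p \<in> ?rhs"
    then have F: "F \<noteq> {}" "F \<subseteq> {..d}" and p': "p \<in> ?A" "p \<in> ?B"
      by (auto split: if_splits)
    have "snd p i - snd p j \<in> R" if "i \<in> F" "j \<notin> F" for i j
    proof (cases "j \<le> Suc d")
      case True
      with that p'(2) show ?thesis by auto
    next
      case False
      have "Suc d \<notin> F" using F by auto
      then have "snd p i - snd p (Suc d) \<in> R"
        using that p'(2) by auto
      moreover have "snd p (Suc d) = 0" "snd p j = 0"
        using p'(1) False by (auto simp: simplices_points_def standard_simplex_def)
      ultimately show ?thesis by simp
    qed
    then show "p \<in> face_piece R c F"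
      using F p'(1) by (auto simp: face_piece_def dominant_def)
  qed
  have cont: "continuous_map Y euclideanreal (\<lambda>p. snd p i - snd p j)" for i j
    by (intro continuous_map_diff continuous_map_coordinate)
  have A: "openin Y ?A" "closedin Y ?A"
    by (rule openin_continuous_map_preimage[OF continuous_map_index]
        closedin_continuous_map_preimage[OF continuous_map_index]; auto)+
  have K: "finite ?K" if "F \<subseteq> {..d}"
    using that finite_subset by auto
  have B: "open R \<Longrightarrow> openin Y ?B" "closed R \<Longrightarrow> closedin Y ?B" if F: "F \<subseteq> {..d}"
  proof -
    show "openin Y ?B" if "open R"
    proof (rule finite_Ball_openin_closedin(1)[OF K[OF F]])
      show "openin Y {p \<in> topspace Y. snd p (fst k) - snd p (snd k) \<in> R}" for k
        by (rule openin_continuous_map_preimage[OF cont]) (use that in simp)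
    qed
    show "closedin Y ?B" if "closed R"
    proof (rule finite_Ball_openin_closedin(2)[OF K[OF F]])
      show "closedin Y {p \<in> topspace Y. snd p (fst k) - snd p (snd k) \<in> R}" for k
        by (rule closedin_continuous_map_preimage[OF cont]) (use that in simp)
    qed
  qed
  show "openin Y (face_piece R c F)" if "open R"
    unfolding eq using openin_Int[OF A(1) B(1)[OF _ that]] by simp
  show "closedin Y (face_piece R c F)" if "closed R"
    unfolding eq using closedin_Int[OF A(2) B(2)[OF _ that]] by simp
qed

lemma star_preimage:
  assumes "R \<subseteq> {0<..}"
  shows "{p \<in> topspace Y. point_class d T p \<in> star R c} = (\<Union>F\<in>Pow {..d}. face_piece R c F)"
proof (intro Set.set_eqI iffI)
  fix p assume p: "p \<in> {p \<in> topspace Y. point_class d T p \<in> star R c}"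
  obtain s x where sx: "p = (s, x)" by (cases p)
  with p have "cls s x \<in> star R c" "s < num_simplices T" "x \<in> standard_simplex d"
    by (auto simp: simplices_points_def)
  then obtain F where "dominant d R F x" "cls s (barycentre F) = c"
    using star_representative[OF _ _ _ assms] by blast
  then have "p \<in> face_piece R c F" "F \<in> Pow {..d}"
    using p sx dominant_subset by (auto simp: face_piece_def)
  then show "p \<in> (\<Union>F\<in>Pow {..d}. face_piece R c F)"
    by blast
next
  fix p assume "p \<in> (\<Union>F\<in>Pow {..d}. face_piece R c F)"
  then show "p \<in> {p \<in> topspace Y. point_class d T p \<in> star R c}"
    by (cases p) (auto simp: face_piece_def simplices_points_def intro: starI)
qed

lemma openin_star:
  assumes "open R" "R \<subseteq> {0<..}"
  shows "openin M (star R c)"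
proof -
  have "openin Y {p \<in> topspace Y. point_class d T p \<in> star R c}"
    unfolding star_preimage[OF assms(2)] using face_piece_open_closed(1)[OF assms(1)] by (intro openin_Union) auto
  then show ?thesis
    using quotient_map_point_class[of d T] star_subset unfolding quotient_map_def by blast
qed

lemma closedin_star:
  assumes "closed R" "R \<subseteq> {0<..}"
  shows "closedin M (star R c)"
proof -
  have "closedin Y {p \<in> topspace Y. point_class d T p \<in> star R c}"
    unfolding star_preimage[OF assms(2)] using face_piece_open_closed(2)[OF assms(1)] by (intro closedin_Union) auto
  then show ?thesis
    using quotient_map_point_class[of d T] star_subset unfolding quotient_map_closedin by blast
qed

text \<open>On each of the finitely many open pieces of the preimage the contraction is an affine formula. The
  product of the quotient map with the unit interval is again a quotient map because the interval is
  locally compact, so continuity descends to the star.\<close>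

lemma continuous_map_contraction:
  "continuous_map (prod_topology (top_of_set {0..1}) (subtopology M (star {0<..} c))) M
    (\<lambda>(t, p). contraction c t p)"
proof -
  let ?I = "top_of_set {0..1::real}"
  let ?U = "{p \<in> topspace Y. point_class d T p \<in> star {0<..} c}"
  let ?P = "prod_topology ?I (subtopology Y ?U)"
  have U: "?U = (\<Union>F\<in>Pow {..d}. face_piece {0<..} c F)"
    by (rule star_preimage) simp
  have q: "quotient_map ?P (prod_topology ?I (subtopology M (star {0<..} c))) (\<lambda>(t, p). (t, point_class d T p))"
  proof (rule quotient_map_prod_right)
    show "locally_compact_space ?I"
      by (intro compact_imp_locally_compact_space compact_space_subtopology) simp
    show "Hausdorff_space ?I \<or> regular_space ?I"
      by (simp add: Hausdorff_space_subtopology)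
    show "quotient_map (subtopology Y ?U) (subtopology M (star {0<..} c)) (point_class d T)"
      by (rule quotient_map_restriction[OF quotient_map_point_class]) (simp_all add: openin_star)
  qed
  have "continuous_map ?P M (\<lambda>(t, p). contraction c t (point_class d T p))"
  proof (rule pasting_lemma[where I = "Pow {..d}" and T = "\<lambda>F. {0..1} \<times> face_piece {0<..} c F"
        and f = "\<lambda>F z. cls (fst (snd z)) (mix (snd (snd z)) (barycentre F) (fst z))"])
    fix F assume F: "F \<in> Pow {..d}"
    show op: "openin ?P ({0..1} \<times> face_piece {0<..} c F)"
      unfolding openin_prod_Times_iff using U F face_piece_open_closed(1)[of "{0<..}" c F]
      by (auto simp: openin_subtopology)
    let ?S = "subtopology ?P ({0..1} \<times> face_piece {0<..} c F)"
    have snd: "continuous_map ?S Y snd"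
      by (intro continuous_map_from_subtopology continuous_map_into_fulltopology[OF continuous_map_snd])
    have fst: "continuous_map ?S euclideanreal fst"
      by (intro continuous_map_from_subtopology continuous_map_into_fulltopology[OF continuous_map_fst])
    show "continuous_map ?S M (\<lambda>z. cls (fst (snd z)) (mix (snd (snd z)) (barycentre F) (fst z)))"
    proof (rule continuous_map_cls)
      show "continuous_map ?S (discrete_topology {..<num_simplices T}) (\<lambda>z. fst (snd z))"
        using continuous_map_compose[OF snd continuous_map_index] by (simp add: o_def)
      show "continuous_map ?S euclideanreal (\<lambda>z. mix (snd (snd z)) (barycentre F) (fst z) i)" for i
        unfolding mix_def using continuous_map_compose[OF snd continuous_map_coordinate[of i]] fst
        by (intro continuous_intros) (auto simp: o_def)
      show "(\<lambda>z. mix (snd (snd z)) (barycentre F) (fst z)) \<in> topspace ?S \<rightarrow> standard_simplex d"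
        by (auto simp: face_piece_def simplices_points_def intro!: mix_in_standard_simplex dominant_barycentre)
    qed
  next
    have *: "contraction c t (point_class d T p) = cls (fst p) (mix (snd p) (barycentre F) t)"
      if "t \<in> {0..1}" "p \<in> face_piece {0<..} c F" for t p F
    proof -
      have "contraction c t (cls (fst p) (snd p)) = cls (fst p) (mix (snd p) (barycentre F) t)"
        using that contraction_cls[of "fst p" "snd p" F t] by (auto simp: face_piece_def simplices_points_def)
      then show ?thesis by simp
    qed
    fix F F' z assume "z \<in> topspace ?P \<inter> ({0..1} \<times> face_piece {0<..} c F) \<inter> ({0..1} \<times> face_piece {0<..} c F')"
    then have "fst z \<in> {0..1}" "snd z \<in> face_piece {0<..} c F" "snd z \<in> face_piece {0<..} c F'"
      by auto
    then show "cls (fst (snd z)) (mix (snd (snd z)) (barycentre F) (fst z)) =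
        cls (fst (snd z)) (mix (snd (snd z)) (barycentre F') (fst z))"
      using * by metis
  next
    fix z assume z: "z \<in> topspace ?P"
    then have "fst z \<in> {0..1}" "snd z \<in> ?U" by auto
    then obtain F where F: "F \<in> Pow {..d}" "snd z \<in> face_piece {0<..} c F"
      unfolding U by blast
    then have "contraction c (fst z) (cls (fst (snd z)) (snd (snd z))) =
        cls (fst (snd z)) (mix (snd (snd z)) (barycentre F) (fst z))"
      using \<open>fst z \<in> {0..1}\<close> contraction_cls[of "fst (snd z)" "snd (snd z)" F "fst z"]
      by (auto simp: face_piece_def simplices_points_def)
    with F \<open>fst z \<in> {0..1}\<close> show "\<exists>F. F \<in> Pow {..d} \<and> z \<in> {0..1} \<times> face_piece {0<..} c F \<and>
      (case z of (t, p) \<Rightarrow> contraction c t (point_class d T p)) =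
        cls (fst (snd z)) (mix (snd (snd z)) (barycentre F) (fst z))"
      by (intro exI[of _ F]) (auto simp: mem_Times_iff split: prod.splits)
  qed
  then have "continuous_map ?P M ((\<lambda>(t, p). contraction c t p) \<circ> (\<lambda>(t, p). (t, point_class d T p)))"
    by (rule continuous_map_eq) auto
  then show ?thesis
    using continuous_compose_quotient_map[OF q] by blast
qed

end

section \<open>Subdividing a curve into pieces within stars\<close>

text \<open>Each coordinate changes at most by the integral of the modulus of its derivative, and this modulus is
  at most the Euclidean norm of the velocity.\<close>

lemma C1_length_bounds_coordinate:
  assumes c: "C1_curve_in_simplex d c c'" and \<kappa>: "\<kappa> > 0" and i: "i \<le> d"
  shows "\<bar>c 1 i - c 0 i\<bar> \<le> C1_length (flat_metric d \<kappa> s) c c' / sqrt \<kappa>"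
proof -
  have cont: "continuous_on {0..1} (\<lambda>t. c' t j)" for j
    by (rule continuous_on_product_then_coordinatewise[of _ c']) (use c in \<open>simp add: C1_curve_in_simplex_def\<close>)
  have "((\<lambda>t. c' t i) has_integral c 1 i - c 0 i) {0..1}"
  proof (rule fundamental_theorem_of_calculus)
    show "((\<lambda>t. c t i) has_vector_derivative c' t i) (at t within {0..1})" if "t \<in> {0..1}" for t
      using c that unfolding C1_curve_in_simplex_def
      by (simp add: has_real_derivative_iff_has_vector_derivative)
  qed simp
  moreover have "((\<lambda>t. sqrt (flat_metric d \<kappa> s (c t) (c' t) (c' t)) / sqrt \<kappa>)
      has_integral C1_length (flat_metric d \<kappa> s) c c' / sqrt \<kappa>) {0..1}"
    unfolding C1_length_def flat_metric_def
    by (intro has_integral_divide integrable_integral integrable_continuous_interval continuous_intros cont)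
  moreover have "\<bar>c' t i\<bar> \<le> sqrt (flat_metric d \<kappa> s (c t) (c' t) (c' t)) / sqrt \<kappa>" for t
  proof -
    have "c' t i * c' t i \<le> (\<Sum>j\<le>d. c' t j * c' t j)"
      using i by (intro member_le_sum) auto
    then have "sqrt ((c' t i)\<^sup>2) \<le> sqrt (\<Sum>j\<le>d. c' t j * c' t j)"
      by (simp only: real_sqrt_le_iff power2_eq_square)
    with \<kappa> show ?thesis
      by (simp add: flat_metric_def real_sqrt_mult)
  qed
  ultimately have "norm (c 1 i - c 0 i) \<le> C1_length (flat_metric d \<kappa> s) c c' / sqrt \<kappa>"
    using integral_norm_bound_integral[of "\<lambda>t. c' t i" "{0..1}"
        "\<lambda>t. sqrt (flat_metric d \<kappa> s (c t) (c' t) (c' t)) / sqrt \<kappa>"]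
    by (auto simp: has_integral_iff)
  then show ?thesis by simp
qed

text \<open>Pigeonhole: with \<open>\<eta>\<close> the claimed margin, the largest coordinate is at least \<open>1 / (d + 1) = (d + 2) \<eta>\<close> and
  lies above the \<open>d + 1\<close> windows from \<open>k \<eta>\<close> to \<open>(k + 1) \<eta>\<close>, \<open>1 \<le> k \<le> d + 1\<close>. The other \<open>d\<close> coordinates
  cannot occupy all of them, and an empty window separates a dominant face from the rest.\<close>

lemma ex_dominant_face:
  assumes x: "x \<in> standard_simplex d"
  shows "\<exists>F. dominant d {1 / ((real d + 1) * (real d + 2))..} F x"
proof -
  define \<eta> where "\<eta> = 1 / ((real d + 1) * (real d + 2))"
  have \<eta>: "\<eta> > 0" by (simp add: \<eta>_def)
  obtain m where m: "m \<le> d" "x m \<ge> (real d + 2) * \<eta>"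
  proof (rule ccontr)
    assume "\<not> thesis"
    with that have "x i < (real d + 2) * \<eta>" if "i \<le> d" for i
      using that by (meson not_le)
    then have "(\<Sum>i\<le>d. x i) < (\<Sum>i\<le>d. (real d + 2) * \<eta>)"
      by (intro sum_strict_mono) auto
    also have "\<dots> = (real d + 1) * ((real d + 2) * (1 / ((real d + 1) * (real d + 2))))"
      by (simp add: \<eta>_def)
    also have "\<dots> = 1"
    proof -
      have "a * (b * (1 / (a * b))) = 1" if "a > 0" "b > 0" for a b :: real
        using that by simp
      then show ?thesis by simp
    qed
    finally show False
      using x by (simp add: standard_simplex_def)
  qed
  obtain k where k: "k \<in> {1..Suc d}" "\<And>i. i \<le> d \<Longrightarrow> \<not> (real k * \<eta> \<le> x i \<and> x i < (real k + 1) * \<eta>)"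
  proof (rule ccontr)
    assume "\<not> thesis"
    with that have "\<forall>k\<in>{1..Suc d}. \<exists>i\<le>d. real k * \<eta> \<le> x i \<and> x i < (real k + 1) * \<eta>"
      by blast
    then obtain i where i: "\<And>k. k \<in> {1..Suc d} \<Longrightarrow> i k \<le> d \<and> real k * \<eta> \<le> x (i k) \<and> x (i k) < (real k + 1) * \<eta>"
      by metis
    have "inj_on i {1..Suc d}"
    proof (rule inj_onI)
      fix k l assume kl: "k \<in> {1..Suc d}" "l \<in> {1..Suc d}" "i k = i l"
      have "real k * \<eta> < (real l + 1) * \<eta>" "real l * \<eta> < (real k + 1) * \<eta>"
        using i[OF kl(1)] i[OF kl(2)] unfolding kl(3) by linarith+
      then show "k = l" using \<eta> by simp
    qed
    moreover have "i ` {1..Suc d} \<subseteq> {..d} - {m}"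
    proof
      fix j assume "j \<in> i ` {1..Suc d}"
      then obtain k where k: "k \<in> {1..Suc d}" "j = i k" by blast
      have "real k + 1 \<le> real d + 2" using k(1) by simp
      then have "(real k + 1) * \<eta> \<le> (real d + 2) * \<eta>"
        using \<eta> by (intro mult_right_mono) auto
      then have "x j < x m" using i[OF k(1)] m(2) unfolding k(2) by linarith
      then show "j \<in> {..d} - {m}" using i[OF k(1)] k(2) by auto
    qed
    ultimately have "card {1..Suc d} \<le> card ({..d} - {m})"
      using card_inj_on_le by blast
    then show False using m(1) by simp
  qed
  define F where "F = {i. i \<le> d \<and> (real k + 1) * \<eta> \<le> x i}"
  have "(real k + 1) * \<eta> \<le> (real d + 2) * \<eta>"
    using k(1) \<eta> by (intro mult_right_mono) auto
  then have "m \<in> F" using m by (simp add: F_def)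
  moreover have "x i - x j \<ge> \<eta>" if "i \<in> F" "j \<notin> F" for i j
  proof -
    have "x j \<le> real k * \<eta>"
    proof (cases "j \<le> d")
      case True
      then show ?thesis using k(2)[OF True] that(2) by (auto simp: F_def)
    next
      case False
      then have "x j = 0" using x by (simp add: standard_simplex_def)
      then show ?thesis using \<eta> by simp
    qed
    with that(1) show ?thesis by (simp add: F_def algebra_simps)
  qed
  ultimately have "dominant d {\<eta>..} F x"
    unfolding dominant_def by (auto simp: F_def)
  then show ?thesis unfolding \<eta>_def by blast
qed

context glued_simplices
begin

lemma star_cover:
  assumes "p \<in> topspace M"
  shows "\<exists>c. p \<in> star {1 / ((real d + 1) * (real d + 2))..} c"
  using assms ex_dominant_face by (metis topspace_M_cases starI)

lemma star_antimono: "\<theta>' \<le> \<theta> \<Longrightarrow> star {\<theta>..} c \<subseteq> star {\<theta>'..} c"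
  by (rule star_mono) auto

lemma star_atLeast_subset: "\<theta> > 0 \<Longrightarrow> star {\<theta>..} c \<subseteq> star {0<..} c"
  by (rule star_mono) auto

lemma C1_length_nonneg:
  assumes "\<kappa> \<ge> 0"
  shows "0 \<le> C1_length (flat_metric d \<kappa> s) c c'"
proof -
  have "0 \<le> sqrt (flat_metric d \<kappa> s (c t) (c' t) (c' t))" for t
    using assms unfolding flat_metric_def
    by (intro real_sqrt_ge_zero mult_nonneg_nonneg sum_nonneg zero_le_square)
  then show ?thesis
    unfolding C1_length_def
    by (cases "(\<lambda>t. sqrt (flat_metric d \<kappa> s (c t) (c' t) (c' t))) integrable_on {0..1}")
      (auto intro: Henstock_Kurzweil_Integration.integral_nonneg simp: not_integrable_integral)
qed

text \<open>The coordinates in the dominant face may decrease and those outside may increase, each by at most the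
  length divided by \<open>sqrt \<kappa>\<close>; hence the factor two. Passing to another simplex does not change the
  margin.\<close>

lemma joined_by_length_star:
  assumes "joined_by_length d T (flat_metric d \<kappa>) p q L" "p \<in> star {\<theta>..} c" and \<kappa>: "\<kappa> > 0"
    and "\<theta> - 2 * L / sqrt \<kappa> > 0"
  shows "q \<in> star {\<theta> - 2 * L / sqrt \<kappa>..} c"
  using assms(1,2,4)
proof induction
  case const
  then show ?case by simp
next
  case (append p s e L e')
  define l where "l = C1_length (flat_metric d \<kappa> s) e e'"
  have sq: "sqrt \<kappa> > 0" using \<kappa> by simp
  have l: "l \<ge> 0" unfolding l_def using \<kappa> by (simp add: C1_length_nonneg)
  have split: "2 * (L + l) / sqrt \<kappa> = 2 * L / sqrt \<kappa> + 2 * (l / sqrt \<kappa>)"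
    by (simp add: add_divide_distrib distrib_left)
  have "l / sqrt \<kappa> \<ge> 0" using l sq by simp
  then have pos: "\<theta> - 2 * L / sqrt \<kappa> > 0"
    using append.prems(2) split unfolding l_def by linarith
  then have p: "cls s (e 0) \<in> star {\<theta> - 2 * L / sqrt \<kappa>..} c"
    using append.IH append.prems(1) by blast
  have e: "e 0 \<in> standard_simplex d" "e 1 \<in> standard_simplex d"
    using append.hyps(3) unfolding C1_curve_in_simplex_def by auto
  obtain F where F: "dominant d {\<theta> - 2 * L / sqrt \<kappa>..} F (e 0)" "cls s (barycentre F) = c"
  proof (rule star_representative[OF p append.hyps(2) e(1)])
    show "{\<theta> - 2 * L / sqrt \<kappa>..} \<subseteq> {0<..}" using pos by auto
  qed
  have diff: "\<bar>e 1 i - e 0 i\<bar> \<le> l / sqrt \<kappa>" for i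
  proof (cases "i \<le> d")
    case True
    then show ?thesis
      unfolding l_def using C1_length_bounds_coordinate append.hyps(3) \<kappa> by blast
  next
    case False
    then show ?thesis
      using e \<open>l / sqrt \<kappa> \<ge> 0\<close> by (simp add: standard_simplex_def)
  qed
  have "dominant d {\<theta> - 2 * (L + l) / sqrt \<kappa>..} F (e 1)"
    unfolding dominant_def
  proof (intro conjI ballI allI impI)
    fix i j assume "i \<in> F" "j \<notin> F"
    then have "e 0 i - e 0 j \<ge> \<theta> - 2 * L / sqrt \<kappa>"
      using F(1) by (simp add: dominant_def)
    then show "e 1 i - e 1 j \<in> {\<theta> - 2 * (L + l) / sqrt \<kappa>..}"
      using diff[of i] diff[of j] split by (simp add: abs_le_iff)
  qed (use F(1) in \<open>auto simp: dominant_def\<close>)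
  then show ?case
    using starI[OF append.hyps(2) e(2)] F(2) unfolding l_def by blast
qed

text \<open>Losing half of the margin costs a definite length. This is where the constant of the theorem
  originates.\<close>

lemma metric_dist_star:
  assumes "metric_dist d T (flat_metric d \<kappa>) p q < ennreal (\<theta> * sqrt \<kappa> / 4)" "p \<in> star {\<theta>..} c"
    and "\<kappa> > 0" "\<theta> > 0"
  shows "q \<in> star {\<theta> / 2..} c"
proof -
  obtain L where L: "joined_by_length d T (flat_metric d \<kappa>) p q L" "ennreal L < ennreal (\<theta> * sqrt \<kappa> / 4)"
    using assms(1) unfolding metric_dist_def Inf_less_iff by blast
  have "L < \<theta> * sqrt \<kappa> / 4"
    using L(2) by (metis ennreal_leI not_le)
  then have "2 * L / sqrt \<kappa> < \<theta> / 2"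
    using assms(3) by (simp add: field_simps)
  then show ?thesis
    using joined_by_length_star[OF L(1) assms(2,3)] star_antimono[of "\<theta> / 2" "\<theta> - 2 * L / sqrt \<kappa>" c] assms(4)
    by auto
qed

text \<open>A subdivision \<open>t 0 \<le> ... \<le> t N\<close> of the interval from \<open>a\<close> to \<open>b\<close> such that \<open>\<gamma>\<close> stays in the star of
  \<open>c j\<close> on the \<open>j\<close>-th piece.\<close>

definition star_chain :: "(real \<Rightarrow> spoint set) \<Rightarrow> real \<Rightarrow> real \<Rightarrow> nat \<Rightarrow> (nat \<Rightarrow> real) \<Rightarrow> (nat \<Rightarrow> spoint set) \<Rightarrow> bool" where
  "star_chain \<gamma> a b N t c \<longleftrightarrow> t 0 = a \<and> t N = b \<and>
    (\<forall>j<N. t j \<le> t (Suc j) \<and> \<gamma> ` {t j..t (Suc j)} \<subseteq> star {0<..} (c j))"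

lemma star_chain_mono:
  assumes "star_chain \<gamma> a b N t c" "i \<le> j" "j \<le> N"
  shows "t i \<le> t j"
  using assms(2,3)
proof (induction j rule: dec_induct)
  case (step j)
  then have "t j \<le> t (Suc j)" using assms(1) by (simp add: star_chain_def)
  with step show ?case by simp
qed simp

lemma star_chain_append:
  assumes "star_chain \<gamma> a b N t c" "star_chain \<gamma> b e N' t' c'"
  shows "star_chain \<gamma> a e (N + N') (\<lambda>j. if j \<le> N then t j else t' (j - N)) (\<lambda>j. if j < N then c j else c' (j - N))"
  unfolding star_chain_def
proof (intro conjI allI impI)
  show "(if 0 \<le> N then t 0 else t' (0 - N)) = a" using assms(1) by (simp add: star_chain_def)
  show "(if N + N' \<le> N then t (N + N') else t' (N + N' - N)) = e"
    using assms by (cases "N' = 0") (auto simp: star_chain_def)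
  fix j assume j: "j < N + N'"
  let ?t = "\<lambda>j. if j \<le> N then t j else t' (j - N)"
  have "?t j \<le> ?t (Suc j) \<and> \<gamma> ` {?t j..?t (Suc j)} \<subseteq> star {0<..} (if j < N then c j else c' (j - N))"
  proof (cases "j < N")
    case True
    then show ?thesis using assms(1) by (simp add: star_chain_def)
  next
    case False
    then have "j - N < N'" "Suc j - N = Suc (j - N)" using j by auto
    moreover have "?t j = t' (j - N)"
      using False assms by (cases "j = N") (auto simp: star_chain_def)
    ultimately show ?thesis
      using False assms(2) unfolding star_chain_def by simp
  qed
  then show "?t j \<le> ?t (Suc j)" "\<gamma> ` {?t j..?t (Suc j)} \<subseteq> star {0<..} (if j < N then c j else c' (j - N))"
    by auto
qed

lemma star_chain_single:
  assumes "a \<le> b" "\<gamma> ` {a..b} \<subseteq> star {0<..} c"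
  shows "star_chain \<gamma> a b 1 (\<lambda>j. if j = 0 then a else b) (\<lambda>_. c)"
  using assms by (auto simp: star_chain_def)

lemma path_star_open:
  assumes "pathin M \<gamma>" "u \<in> {0..1}" "\<gamma> u \<in> star {0<..} c"
  shows "\<exists>\<epsilon>>0. \<forall>v\<in>{0..1}. \<bar>v - u\<bar> < \<epsilon> \<longrightarrow> \<gamma> v \<in> star {0<..} c"
proof -
  have "openin (top_of_set {0..1}) {v \<in> topspace (top_of_set {0..1}). \<gamma> v \<in> star {0<..} c}"
    using assms(1) openin_star[of "{0<..}" c] unfolding pathin_def
    by (intro openin_continuous_map_preimage) auto
  then obtain \<epsilon> where "\<epsilon> > 0" "\<And>v. v \<in> {0..1} \<Longrightarrow> dist v u < \<epsilon> \<Longrightarrow> \<gamma> v \<in> star {0<..} c"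
    unfolding openin_euclidean_subtopology_iff using assms(2,3) by auto
  then show ?thesis
    by (auto simp: dist_real_def)
qed

text \<open>For curves of infinite length the number of pieces is irrelevant, and compactness of the interval
  provides a subdivision.\<close>

lemma ex_star_chain:
  assumes "pathin M \<gamma>"
  shows "\<exists>N t c. star_chain \<gamma> 0 1 N t c"
proof -
  define P where "P a b \<longleftrightarrow> (0 \<le> a \<and> b \<le> 1 \<longrightarrow> (\<exists>N t c. star_chain \<gamma> a b N t c))" for a b
  have "P 0 1"
  proof (rule Bolzano)
    show "P a e" if "P a b" "P b e" "a \<le> b" "b \<le> e" for a b e
      using that star_chain_append unfolding P_def by (meson order_trans)
    show "\<exists>\<epsilon>>0. \<forall>a b. a \<le> x \<and> x \<le> b \<and> b - a < \<epsilon> \<longrightarrow> P a b" if x: "0 \<le> x" "x \<le> 1" for x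
    proof -
      have "\<gamma> x \<in> topspace M"
        using continuous_map_funspace[OF assms[unfolded pathin_def]] x by (auto simp: Pi_iff)
      then obtain c where "\<gamma> x \<in> star {1 / ((real d + 1) * (real d + 2))..} c"
        using star_cover by blast
      then have "\<gamma> x \<in> star {0<..} c"
        using star_atLeast_subset[of "1 / ((real d + 1) * (real d + 2))" c] by auto
      then obtain \<epsilon> where \<epsilon>: "\<epsilon> > 0" "\<And>v. v \<in> {0..1} \<Longrightarrow> \<bar>v - x\<bar> < \<epsilon> \<Longrightarrow> \<gamma> v \<in> star {0<..} c"
        using path_star_open[OF assms, of x c] x by auto
      have "P a b" if "a \<le> x" "x \<le> b" "b - a < \<epsilon>" for a b
      proof -
        have "\<gamma> ` {a..b} \<subseteq> star {0<..} c" if "0 \<le> a" "b \<le> 1"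
          using that \<open>a \<le> x\<close> \<open>x \<le> b\<close> \<open>b - a < \<epsilon>\<close> by (auto intro!: \<epsilon>(2))
        then show ?thesis
          unfolding P_def using star_chain_single[of a b \<gamma> c] that by fastforce
      qed
      then show ?thesis using \<epsilon>(1) by blast
    qed
  qed simp
  then show ?thesis by (simp add: P_def)
qed

text \<open>One greedy step: follow the curve until the margin of a face that dominates at \<open>\<gamma> a\<close> has dropped to
  less than half.\<close>

lemma star_chain_extend:
  assumes \<gamma>: "pathin M \<gamma>" and m: "m = flat_metric d \<kappa>" "\<kappa> > 0"
    and a: "a \<in> {0..1}" and \<theta>: "\<theta> > 0" "\<gamma> a \<in> star {\<theta>..} c"
  obtains "\<gamma> ` {a..1} \<subseteq> star {0<..} c"
  | b where "a \<le> b" "b \<le> 1" "\<gamma> ` {a..b} \<subseteq> star {0<..} c"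
    "ennreal (\<theta> * sqrt \<kappa> / 4) \<le> metric_dist d T m (\<gamma> a) (\<gamma> b)"
proof (cases "\<gamma> ` {a..1} \<subseteq> star {\<theta> / 2..} c")
  case True
  then have "\<gamma> ` {a..1} \<subseteq> star {0<..} c"
    using star_atLeast_subset[of "\<theta> / 2" c] \<theta>(1) by simp
  then show ?thesis by (rule that(1))
next
  case False
  define B where "B = {t \<in> {a..1}. \<gamma> t \<notin> star {\<theta> / 2..} c}"
  have B: "B \<noteq> {}" "bdd_below B" "B \<subseteq> {a..1}"
    using False by (auto simp: B_def intro!: bdd_belowI[of _ a])
  \<comment> \<open>At \<open>t1\<close> itself the margin is still \<open>\<theta> / 2\<close>; the next division point is taken in \<open>B\<close>, so close to \<open>t1\<close> that the curve is still in the open star.\<close>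
  define t1 where "t1 = Inf B"
  have t1: "a \<le> t1" "t1 \<le> 1"
    using B cInf_greatest[OF B(1), of a] cInf_lower[OF _ B(2)] unfolding t1_def by force+
  have before: "\<gamma> t \<in> star {\<theta> / 2..} c" if "a \<le> t" "t < t1" for t
  proof (rule ccontr)
    assume "\<gamma> t \<notin> star {\<theta> / 2..} c"
    then have "t \<in> B" using that t1 by (simp add: B_def)
    then have "t1 \<le> t" unfolding t1_def using B(2) by (rule cInf_lower)
    with that(2) show False by simp
  qed
  have sub: "star {\<theta> / 2..} c \<subseteq> star {0<..} c"
    using \<theta>(1) by (intro star_atLeast_subset) simp
  have "\<gamma> t1 \<in> star {\<theta> / 2..} c"
  proof (cases "a = t1")
    case True
    then show ?thesis
      using \<theta> star_antimono[of "\<theta> / 2" \<theta> c] by auto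
  next
    case False
    have "closedin (top_of_set {0..1}) {t \<in> topspace (top_of_set {0..1}). \<gamma> t \<in> star {\<theta> / 2..} c}"
    proof (rule closedin_continuous_map_preimage)
      show "closedin M (star {\<theta> / 2..} c)"
        using \<theta>(1) by (intro closedin_star) auto
    qed (use \<gamma> in \<open>simp add: pathin_def\<close>)
    then have "closed {t \<in> {0..1}. \<gamma> t \<in> star {\<theta> / 2..} c}"
      using closedin_closed_trans by fastforce
    moreover have "{a..<t1} \<subseteq> {t \<in> {0..1}. \<gamma> t \<in> star {\<theta> / 2..} c}"
      using before a t1 by auto
    ultimately have "closure {a..<t1} \<subseteq> {t \<in> {0..1}. \<gamma> t \<in> star {\<theta> / 2..} c}"
      by (rule closure_minimal[rotated])
    moreover have "t1 \<in> closure {a..<t1}"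
      using False t1 by simp
    ultimately show ?thesis by blast
  qed
  then have "\<gamma> t1 \<in> star {0<..} c" using sub by blast
  then obtain \<epsilon> where \<epsilon>: "\<epsilon> > 0" "\<And>v. v \<in> {0..1} \<Longrightarrow> \<bar>v - t1\<bar> < \<epsilon> \<Longrightarrow> \<gamma> v \<in> star {0<..} c"
    using path_star_open[OF \<gamma>, of t1 c] t1 a by auto
  obtain b where b: "b \<in> B" "b < t1 + \<epsilon>"
    using \<epsilon>(1) cInf_lessD[OF B(1), of "t1 + \<epsilon>"] unfolding t1_def by auto
  have "t1 \<le> b" unfolding t1_def using b(1) B(2) by (rule cInf_lower)
  have "\<gamma> v \<in> star {0<..} c" if "v \<in> {a..b}" for v
  proof (cases "v < t1")
    case True
    then show ?thesis using before that sub by auto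
  next
    case False
    then show ?thesis using that b B(3) a by (intro \<epsilon>(2)) auto
  qed
  moreover have "ennreal (\<theta> * sqrt \<kappa> / 4) \<le> metric_dist d T m (\<gamma> a) (\<gamma> b)"
    using metric_dist_star[OF _ \<theta>(2) m(2) \<theta>(1), of "\<gamma> b"] b(1) unfolding m(1) B_def by (force simp: not_less[symmetric])
  ultimately show ?thesis
    using b(1) B(3) by (intro that(2)[of b]) auto
qed

lemma curve_length_ge_sum:
  assumes "\<And>j. j < k \<Longrightarrow> t j \<le> t (Suc j)" "0 \<le> t 0" "t k \<le> 1"
  shows "(\<Sum>j<k. metric_dist d T m (\<gamma> (t j)) (\<gamma> (t (Suc j)))) \<le> curve_length d T m \<gamma>"
proof -
  have mono: "t i \<le> t j" if "i \<le> j" "j \<le> k" for i j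
    using that
  proof (induction j rule: dec_induct)
    case (step j)
    then show ?case using assms(1)[of j] by simp
  qed simp
  let ?ts = "map t [0..<Suc k]"
  have "sorted ?ts"
    unfolding sorted_iff_nth_mono using mono by (auto simp del: upt_Suc)
  moreover have "set ?ts \<subseteq> {0..1}"
  proof -
    have "t j \<in> {0..1}" if "j \<le> k" for j
      using mono[of 0 j] mono[of j k] that assms(2,3) by simp
    then show ?thesis
      by (auto simp del: upt_Suc)
  qed
  ultimately have "(\<Sum>i<length ?ts - 1. metric_dist d T m (\<gamma> (?ts ! i)) (\<gamma> (?ts ! Suc i))) \<le> curve_length d T m \<gamma>"
    unfolding curve_length_def by (intro SUP_upper) blast
  moreover have "(\<Sum>i<length ?ts - 1. metric_dist d T m (\<gamma> (?ts ! i)) (\<gamma> (?ts ! Suc i))) =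
      (\<Sum>j<k. metric_dist d T m (\<gamma> (t j)) (\<gamma> (t (Suc j))))"
    by (intro sum.cong) (simp_all del: upt_Suc)
  ultimately show ?thesis by simp
qed

lemma ex_star_chain_or_long:
  assumes \<gamma>: "pathin M \<gamma>" and m: "m = flat_metric d \<kappa>" "\<kappa> > 0"
    and \<theta>: "\<theta> = 1 / ((real d + 1) * (real d + 2))"
  shows "(\<exists>N\<le>k. \<exists>t c. star_chain \<gamma> 0 1 N t c) \<or>
    (\<exists>t c. star_chain \<gamma> 0 (t k) k t c \<and> t k \<le> 1 \<and>
      (\<forall>j<k. ennreal (\<theta> * sqrt \<kappa> / 4) \<le> metric_dist d T m (\<gamma> (t j)) (\<gamma> (t (Suc j)))))"
proof (induction k)
  case 0
  show ?case
    by (intro disjI2 exI[of _ "\<lambda>_. 0"]) (simp add: star_chain_def)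
next
  case (Suc k)
  show ?case
  proof (cases "\<exists>N\<le>k. \<exists>t c. star_chain \<gamma> 0 1 N t c")
    case True
    then show ?thesis by (meson le_SucI)
  next
    case False
    then obtain t c where tc: "star_chain \<gamma> 0 (t k) k t c" "t k \<le> 1"
      "\<And>j. j < k \<Longrightarrow> ennreal (\<theta> * sqrt \<kappa> / 4) \<le> metric_dist d T m (\<gamma> (t j)) (\<gamma> (t (Suc j)))"
      using Suc by blast
    have tk: "t k \<in> {0..1}"
      using star_chain_mono[OF tc(1), of 0 k] tc(1,2) by (simp add: star_chain_def)
    then have "\<gamma> (t k) \<in> topspace M"
      using continuous_map_funspace[OF \<gamma>[unfolded pathin_def]] by (auto simp: Pi_iff)
    then obtain e where e: "\<gamma> (t k) \<in> star {\<theta>..} e"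
      using star_cover unfolding \<theta> by blast
    have "\<theta> > 0" by (simp add: \<theta>)
    from \<gamma> m tk this e show ?thesis
    proof (cases rule: star_chain_extend)
      case 1
      then have "\<exists>t c. star_chain \<gamma> 0 1 (Suc k) t c"
        using star_chain_append[OF tc(1) star_chain_single[of "t k" 1 \<gamma> e]] tk by fastforce
      then show ?thesis by blast
    next
      case (2 b)
      let ?t = "\<lambda>j. if j \<le> k then t j else if j - k = 0 then t k else b"
      have "star_chain \<gamma> 0 (?t (Suc k)) (Suc k) ?t (\<lambda>j. if j < k then c j else e)"
        using star_chain_append[OF tc(1) star_chain_single[OF 2(1,3)]] by simp
      moreover have "ennreal (\<theta> * sqrt \<kappa> / 4) \<le> metric_dist d T m (\<gamma> (?t j)) (\<gamma> (?t (Suc j)))" if "j < Suc k" for j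
        using that tc(3) 2(4) by (cases "j = k") auto
      ultimately show ?thesis
        using 2(2) by (intro disjI2 exI[of _ ?t] exI[of _ "\<lambda>j. if j < k then c j else e"]) auto
    qed
  qed
qed

text \<open>Every greedy step but the last uses up length \<open>\<delta>\<close>, so the number of pieces exceeds the length
  divided by \<open>\<delta>\<close> at most by one.\<close>

lemma ex_short_star_chain:
  assumes \<gamma>: "pathin M \<gamma>" and \<kappa>: "\<kappa> > 0"
    and \<delta>: "\<delta> = 1 / ((real d + 1) * (real d + 2)) * sqrt \<kappa> / 4"
  shows "\<exists>N t c. star_chain \<gamma> 0 1 N t c \<and> N > 0 \<and>
    of_nat (N - 1) * ennreal \<delta> \<le> curve_length d T (flat_metric d \<kappa>) \<gamma>"
proof -
  let ?L = "curve_length d T (flat_metric d \<kappa>) \<gamma>"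
  have \<delta>_pos: "\<delta> > 0" using \<kappa> by (simp add: \<delta>)
  have N_pos: "N > 0" if "star_chain \<gamma> 0 1 N t c" for N t c
    using that by (cases N) (auto simp: star_chain_def)
  show ?thesis
  proof (cases "?L = \<top>")
    case True
    then show ?thesis
      using ex_star_chain[OF \<gamma>] N_pos by fastforce
  next
    case False
    then obtain L where L: "?L = ennreal L" "L \<ge> 0"
      by (metis ennreal_cases)
    define k where "k = Suc (nat \<lfloor>L / \<delta>\<rfloor>)"
    have "real (k - 1) = of_int \<lfloor>L / \<delta>\<rfloor>" "real k = of_int \<lfloor>L / \<delta>\<rfloor> + 1"
      using L(2) \<delta>_pos by (simp_all add: k_def)
    then have "L / \<delta> < real k" "real (k - 1) \<le> L / \<delta>"
      by linarith+
    then have k: "L < real k * \<delta>" "real (k - 1) * \<delta> \<le> L"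
      using \<delta>_pos by (simp_all add: field_simps)
    have "\<not> (\<exists>t c. star_chain \<gamma> 0 (t k) k t c \<and> t k \<le> 1 \<and>
      (\<forall>j<k. ennreal \<delta> \<le> metric_dist d T (flat_metric d \<kappa>) (\<gamma> (t j)) (\<gamma> (t (Suc j)))))"
    proof
      assume "\<exists>t c. star_chain \<gamma> 0 (t k) k t c \<and> t k \<le> 1 \<and>
        (\<forall>j<k. ennreal \<delta> \<le> metric_dist d T (flat_metric d \<kappa>) (\<gamma> (t j)) (\<gamma> (t (Suc j))))"
      then obtain t c where tc: "star_chain \<gamma> 0 (t k) k t c" "t k \<le> 1"
        "\<And>j. j < k \<Longrightarrow> ennreal \<delta> \<le> metric_dist d T (flat_metric d \<kappa>) (\<gamma> (t j)) (\<gamma> (t (Suc j)))"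
        by blast
      have "(\<Sum>j<k. ennreal \<delta>) \<le> (\<Sum>j<k. metric_dist d T (flat_metric d \<kappa>) (\<gamma> (t j)) (\<gamma> (t (Suc j))))"
        using tc(3) by (intro sum_mono) auto
      also have "\<dots> \<le> ?L"
        using tc(1,2) by (intro curve_length_ge_sum) (auto simp: star_chain_def)
      finally have "ennreal (real k * \<delta>) \<le> ennreal L"
        using \<delta>_pos by (simp add: L ennreal_mult ennreal_of_nat_eq_real_of_nat)
      then show False
        using k(1) L(2) by (simp add: ennreal_le_iff)
    qed
    then obtain N t c where N: "N \<le> k" "star_chain \<gamma> 0 1 N t c"
      using ex_star_chain_or_long[OF \<gamma> refl \<kappa> refl, of k] unfolding \<delta> by blast
    have "real (N - 1) * \<delta> \<le> real (k - 1) * \<delta>"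
      using N(1) \<delta>_pos by (intro mult_right_mono) auto
    with k(2) have "ennreal (real (N - 1) * \<delta>) \<le> ennreal L"
      by (intro ennreal_leI) simp
    then have "of_nat (N - 1) * ennreal \<delta> \<le> ?L"
      using \<delta>_pos by (simp add: L ennreal_mult ennreal_of_nat_eq_real_of_nat)
    with N(2) N_pos show ?thesis by blast
  qed
qed

end

section \<open>Pushing a curve onto edges\<close>

context glued_simplices
begin

text \<open>Each class of faces gets one path from its barycentre to a vertex of one of its members, and transport
  along the identifications turns it into a straight path in every other member. Choosing the paths,
  rather than the vertices, compatibly also covers faces that are identified with themselves by a
  nontrivial permutation of their vertices.\<close>

lemma ex_compatible_vertices:
  obtains A where "\<And>s F. s < num_simplices T \<Longrightarrow> F \<noteq> {} \<Longrightarrow> F \<subseteq> {..d} \<Longrightarrow> A s F \<in> F"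
    and "\<And>s F s' F' \<sigma>. s < num_simplices T \<Longrightarrow> F \<noteq> {} \<Longrightarrow> F \<subseteq> {..d} \<Longrightarrow>
      s' < num_simplices T \<Longrightarrow> F' \<noteq> {} \<Longrightarrow> F' \<subseteq> {..d} \<Longrightarrow>
      cls s (barycentre F) = cls s' (barycentre F') \<Longrightarrow> \<sigma> \<in> {0..1} \<Longrightarrow>
      cls s (mix (barycentre F) (simplex_vertex (A s F)) \<sigma>) =
        cls s' (mix (barycentre F') (simplex_vertex (A s' F')) \<sigma>)"
proof -
  define face where "face s F c \<longleftrightarrow> s < num_simplices T \<and> F \<noteq> {} \<and> F \<subseteq> {..d} \<and> cls s (barycentre F) = c" for s F c
  have "\<exists>path. \<forall>s F. face s F c \<longrightarrow>
      (\<exists>a\<in>F. \<forall>\<sigma>\<in>{0..1}. cls s (mix (barycentre F) (simplex_vertex a) \<sigma>) = path \<sigma>)" for c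
  proof (cases "\<exists>s F. face s F c")
    case False
    then show ?thesis by blast
  next
    case True
    then obtain s0 F0 a0 where F0: "face s0 F0 c" "a0 \<in> F0"
      unfolding face_def by blast
    have F0': "F0 \<noteq> {}" "F0 \<subseteq> {..d}" "s0 < num_simplices T" "cls s0 (barycentre F0) = c"
      using F0(1) by (auto simp: face_def)
    have "\<exists>a\<in>F. \<forall>\<sigma>\<in>{0..1}. cls s (mix (barycentre F) (simplex_vertex a) \<sigma>) =
        cls s0 (mix (barycentre F0) (simplex_vertex a0) \<sigma>)" if "face s F c" for s F
    proof -
      have F: "F \<noteq> {}" "F \<subseteq> {..d}" "s < num_simplices T" "cls s (barycentre F) = c"
        using that by (auto simp: face_def)
      have fin: "finite F0" "finite F"
        using F0'(2) F(2) finite_subset by blast+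
      have eq: "cls s0 (barycentre F0) = cls s (barycentre F)"
        using F0'(4) F(4) by simp
      obtain \<pi> where \<pi>: "\<pi> permutes {..d}" "barycentre F = barycentre F0 \<circ> inv_into UNIV \<pi>"
        and tr: "\<And>y. y \<in> standard_simplex d \<Longrightarrow> (\<And>i. barycentre F0 i = 0 \<Longrightarrow> y i = 0) \<Longrightarrow>
          cls s (y \<circ> inv_into UNIV \<pi>) = cls s0 y"
        by (rule transport[OF eq F0'(3) barycentre_in_standard_simplex[OF F0'(1,2)]]) blast
      have "\<pi> a0 \<in> F"
      proof -
        have "barycentre F (\<pi> a0) = barycentre F0 a0"
          unfolding \<pi>(2) using permutes_inverses(2)[OF \<pi>(1)] by simp
        also have "\<dots> \<noteq> 0" using F0(2) fin(1) by (simp add: barycentre_eq_0_iff)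
        finally show ?thesis using barycentre_eq_0_iff[OF fin(2)] by blast
      qed
      moreover have "cls s (mix (barycentre F) (simplex_vertex (\<pi> a0)) \<sigma>) =
          cls s0 (mix (barycentre F0) (simplex_vertex a0) \<sigma>)" if "\<sigma> \<in> {0..1}" for \<sigma>
      proof -
        have "mix (barycentre F0) (simplex_vertex a0) \<sigma> \<in> standard_simplex d"
          using F0'(1,2) F0(2) that
          by (intro mix_in_standard_simplex barycentre_in_standard_simplex simplex_vertex_in_standard_simplex) auto
        moreover have "mix (barycentre F0) (simplex_vertex a0) \<sigma> i = 0" if "barycentre F0 i = 0" for i
        proof -
          have "i \<noteq> a0" using that F0(2) barycentre_eq_0_iff[OF fin(1)] by blast
          then show ?thesis using that by (simp add: mix_def simplex_vertex_def)
        qed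
        ultimately have "cls s (mix (barycentre F0) (simplex_vertex a0) \<sigma> \<circ> inv_into UNIV \<pi>) =
            cls s0 (mix (barycentre F0) (simplex_vertex a0) \<sigma>)"
          by (rule tr)
        then show ?thesis
          unfolding mix_comp simplex_vertex_comp_inv[OF \<pi>(1)] \<pi>(2) .
      qed
      ultimately show ?thesis by blast
    qed
    then show ?thesis
      by (intro exI[of _ "\<lambda>\<sigma>. cls s0 (mix (barycentre F0) (simplex_vertex a0) \<sigma>)"] allI impI)
  qed
  then have "\<forall>c. \<exists>path. \<forall>s F. face s F c \<longrightarrow>
      (\<exists>a\<in>F. \<forall>\<sigma>\<in>{0..1}. cls s (mix (barycentre F) (simplex_vertex a) \<sigma>) = path \<sigma>)"
    by (rule allI)
  from choice[OF this] obtain path where "\<forall>c s F. face s F c \<longrightarrow>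
      (\<exists>a\<in>F. \<forall>\<sigma>\<in>{0..1}. cls s (mix (barycentre F) (simplex_vertex a) \<sigma>) = path c \<sigma>)"
    by (elim exE) (rule that)
  then have path: "\<exists>a\<in>F. \<forall>\<sigma>\<in>{0..1}. cls s (mix (barycentre F) (simplex_vertex a) \<sigma>) = path c \<sigma>"
    if "face s F c" for c s F
    using that by simp
  define A where "A s F = (SOME a. a \<in> F \<and> (\<forall>\<sigma>\<in>{0..1}. cls s (mix (barycentre F) (simplex_vertex a) \<sigma>) =
      path (cls s (barycentre F)) \<sigma>))" for s F
  have A: "A s F \<in> F \<and> (\<forall>\<sigma>\<in>{0..1}. cls s (mix (barycentre F) (simplex_vertex (A s F)) \<sigma>) =
      path (cls s (barycentre F)) \<sigma>)" if "s < num_simplices T" "F \<noteq> {}" "F \<subseteq> {..d}" for s F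
  proof -
    have "face s F (cls s (barycentre F))"
      using that by (simp add: face_def)
    from path[OF this] show ?thesis
      unfolding A_def Bex_def by (rule someI_ex)
  qed
  show ?thesis
    by (rule that[of A]) (simp_all add: A)
qed

lemma contraction_0: "p \<in> star {0<..} c \<Longrightarrow> contraction c 0 p = p"
  unfolding star_def using contraction_cls[of _ _ _ 0] by auto

lemma contraction_1: "p \<in> star {0<..} c \<Longrightarrow> contraction c 1 p = c"
  unfolding star_def using contraction_cls[of _ _ _ 1] by auto

lemma continuous_map_contraction_compose:
  assumes "continuous_map X (top_of_set {0..1}) f" "continuous_map X M g" "g \<in> topspace X \<rightarrow> star {0<..} c"
  shows "continuous_map X M (\<lambda>z. contraction c (f z) (g z))"
proof -
  have "continuous_map X (prod_topology (top_of_set {0..1}) (subtopology M (star {0<..} c))) (\<lambda>z. (f z, g z))"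
    using assms by (simp add: continuous_map_pairedI continuous_map_in_subtopology)
  from continuous_map_compose[OF this continuous_map_contraction] show ?thesis
    by (simp add: o_def)
qed

text \<open>The closed curve is cut at the division points \<open>t j\<close> in such a way that the \<open>j\<close>-th new piece starts in
  the middle of the contracted old piece before \<open>t j\<close>, at the barycentre of its star, and ends at that of the
  star after \<open>t j\<close>; the star before \<open>t 0\<close> is the one before \<open>t N\<close>. The piece first returns from the
  contraction towards the former star (time up to \<open>1 / 2\<close>), is then contracted in the latter star
  (up to \<open>3 / 4\<close>), and only then runs through the old piece from \<open>t j\<close> to \<open>t (Suc j)\<close>, which at the end of the
  contraction has become constant.\<close>

definition cyclic_pred :: "nat \<Rightarrow> nat \<Rightarrow> nat" where
  "cyclic_pred N j = (if j = 0 then N - 1 else j - 1)"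

definition late_run :: "(nat \<Rightarrow> real) \<Rightarrow> nat \<Rightarrow> real \<Rightarrow> real" where
  "late_run t j \<tau> = t j + max 0 (4 * \<tau> - 3) * (t (Suc j) - t j)"

definition contraction_piece ::
  "(real \<Rightarrow> spoint set) \<Rightarrow> nat \<Rightarrow> (nat \<Rightarrow> real) \<Rightarrow> (nat \<Rightarrow> spoint set) \<Rightarrow> real \<Rightarrow> nat \<Rightarrow> real \<Rightarrow> spoint set" where
  "contraction_piece \<gamma> N t c \<sigma> j \<tau> =
    (if \<tau> \<le> 1 / 2 then contraction (c (cyclic_pred N j)) (\<sigma> * max 0 (1 - 2 * \<tau>)) (\<gamma> (t j))
     else contraction (c j) (\<sigma> * max 0 (min 1 (4 * \<tau> - 2))) (\<gamma> (late_run t j \<tau>)))"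

text \<open>At \<open>\<sigma> = 0\<close> the pieces form a reparametrisation of \<open>\<gamma>\<close>, and the contraction parameter \<open>\<sigma>\<close> deforms it into
  a curve through the barycentres of the stars. The last two claims place the points that are contracted
  inside the respective stars.\<close>

lemma homotopic_to_barycentric_curve:
  assumes \<gamma>: "closed_curve M \<gamma>" and chain: "star_chain \<gamma> 0 1 N t c" and N: "N > 0"
  defines "prev \<equiv> cyclic_pred N" and "run \<equiv> late_run t" and "h \<equiv> contraction_piece \<gamma> N t c"
  shows "homotopic_closed_curves M \<gamma> (glue N (h 1))"
    and "\<And>j. j < N \<Longrightarrow> \<gamma> (t j) \<in> star {0<..} (c (prev j)) \<inter> star {0<..} (c j)"
    and "\<And>j \<tau>. j < N \<Longrightarrow> \<tau> \<in> {0..1} \<Longrightarrow> \<gamma> (run j \<tau>) \<in> star {0<..} (c j)"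
proof -
  let ?I = "top_of_set {0..1::real}"
  have prev_def: "prev j = (if j = 0 then N - 1 else j - 1)" for j
    by (simp add: prev_def cyclic_pred_def)
  have run_def: "run j \<tau> = t j + max 0 (4 * \<tau> - 3) * (t (Suc j) - t j)" for j \<tau>
    by (simp add: run_def late_run_def)
  have h_def: "h \<sigma> j \<tau> =
      (if \<tau> \<le> 1 / 2 then contraction (c (prev j)) (\<sigma> * max 0 (1 - 2 * \<tau>)) (\<gamma> (t j))
       else contraction (c j) (\<sigma> * max 0 (min 1 (4 * \<tau> - 2))) (\<gamma> (run j \<tau>)))" for \<sigma> j \<tau>
    by (simp add: h_def contraction_piece_def assms(4) assms(5))
  have ends: "t 0 = 0" "t N = 1" and step: "\<And>j. j < N \<Longrightarrow> t j \<le> t (Suc j)"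
    and in_star: "\<And>j u. j < N \<Longrightarrow> u \<in> {t j..t (Suc j)} \<Longrightarrow> \<gamma> u \<in> star {0<..} (c j)"
    using chain unfolding star_chain_def by blast+
  have cont: "continuous_map ?I M \<gamma>" and closed: "\<gamma> 1 = \<gamma> 0"
    using \<gamma> by (auto simp: closed_curve_def pathin_def)
  have t01: "t j \<in> {0..1}" if "j \<le> N" for j
    using star_chain_mono[OF chain, of 0 j] star_chain_mono[OF chain, of j N] that ends by simp
  have run: "run j \<tau> \<in> {t j..t (Suc j)}" if "j < N" "\<tau> \<in> {0..1}" for j \<tau>
  proof -
    have "max 0 (4 * \<tau> - 3) * (t (Suc j) - t j) \<le> 1 * (t (Suc j) - t j)"
      using that step[OF that(1)] by (intro mult_right_mono) auto
    moreover have "0 \<le> max 0 (4 * \<tau> - 3) * (t (Suc j) - t j)"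
      using step[OF that(1)] by simp
    ultimately show ?thesis unfolding run_def by simp
  qed
  have run01: "run j \<tau> \<in> {0..1}" if "j < N" "\<tau> \<in> {0..1}" for j \<tau>
    using run[OF that] t01[of j] t01[of "Suc j"] that(1) by simp
  show run_star: "\<gamma> (run j \<tau>) \<in> star {0<..} (c j)" if "j < N" "\<tau> \<in> {0..1}" for j \<tau>
    using in_star[OF that(1) run[OF that]] .
  have run_ends: "run j 0 = t j" "run j 1 = t (Suc j)" for j
    by (simp_all add: run_def)
  have prev_star: "\<gamma> (t j) \<in> star {0<..} (c (prev j))" if "j < N" for j
  proof (cases "j = 0")
    case True
    then have "\<gamma> (t j) = \<gamma> (t (Suc (N - 1)))"
      using ends closed N by simp
    then show ?thesis
      using in_star[of "N - 1" "t (Suc (N - 1))"] step[of "N - 1"] N True by (simp add: prev_def)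
  next
    case False
    then show ?thesis
      using in_star[of "j - 1" "t j"] step[of "j - 1"] that by (simp add: prev_def)
  qed
  have cur_star: "\<gamma> (t j) \<in> star {0<..} (c j)" if "j < N" for j
    using in_star[OF that, of "t j"] step[OF that] by simp
  show "\<gamma> (t j) \<in> star {0<..} (c (prev j)) \<inter> star {0<..} (c j)" if "j < N" for j
    using prev_star cur_star that by blast
  have fst_c: "continuous_map (prod_topology ?I ?I) euclideanreal fst"
    and snd_c: "continuous_map (prod_topology ?I ?I) euclideanreal snd"
    using continuous_map_fst continuous_map_snd continuous_map_into_fulltopology by blast+
  have cont_h: "continuous_map (prod_topology ?I ?I) M (\<lambda>(\<sigma>, \<tau>). h \<sigma> j \<tau>)" if j: "j < N" for j
  proof -
    let ?f1 = "\<lambda>z. contraction (c (prev j)) (fst z * max 0 (1 - 2 * snd z)) (\<gamma> (t j))"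
    let ?f2 = "\<lambda>z. contraction (c j) (fst z * max 0 (min 1 (4 * snd z - 2))) (\<gamma> (run j (snd z)))"
    have factor: "continuous_map (prod_topology ?I ?I) ?I (\<lambda>z. fst z * f (snd z))"
      if cf: "continuous_map (prod_topology ?I ?I) euclideanreal (\<lambda>z. f (snd z))" and f01: "\<And>x. x \<in> {0..1} \<Longrightarrow> f x \<in> {0..1}" for f
    proof -
      have "continuous_map (prod_topology ?I ?I) euclideanreal (\<lambda>z. fst z * f (snd z))"
        using fst_c cf by (rule continuous_map_real_mult)
      moreover have "fst z * f (snd z) \<in> {0..1}" if "z \<in> topspace (prod_topology ?I ?I)" for z
      proof -
        have z: "fst z \<in> {0..1}" "snd z \<in> {0..1}"
          using that by auto
        from z(1) f01[OF z(2)] show ?thesis by (simp add: mult_le_one)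
      qed
      ultimately show ?thesis
        by (simp only: continuous_map_in_subtopology) blast
    qed
    have "continuous_map (prod_topology ?I ?I) M ?f1"
    proof (rule continuous_map_contraction_compose)
      show "continuous_map (prod_topology ?I ?I) ?I (\<lambda>z. fst z * max 0 (1 - 2 * snd z))"
        by (rule factor[of "\<lambda>x. max 0 (1 - 2 * x)"]) (auto intro!: continuous_intros snd_c)
      show "continuous_map (prod_topology ?I ?I) M (\<lambda>z. \<gamma> (t j))"
        using prev_star[OF j] star_subset by auto
    qed (use prev_star[OF j] in auto)
    moreover have "continuous_map (prod_topology ?I ?I) M ?f2"
    proof (rule continuous_map_contraction_compose)
      show "continuous_map (prod_topology ?I ?I) ?I (\<lambda>z. fst z * max 0 (min 1 (4 * snd z - 2)))"
        by (rule factor[of "\<lambda>x. max 0 (min 1 (4 * x - 2))"]) (auto intro!: continuous_intros snd_c)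
      have "continuous_map (prod_topology ?I ?I) euclideanreal (\<lambda>z. run j (snd z))"
        unfolding run_def by (intro continuous_intros snd_c) auto
      moreover have "run j (snd z) \<in> {0..1}" if "z \<in> topspace (prod_topology ?I ?I)" for z
        using that by (intro run01[OF j]) auto
      ultimately have "continuous_map (prod_topology ?I ?I) ?I (\<lambda>z. run j (snd z))"
        by (simp only: continuous_map_in_subtopology) blast
      from continuous_map_compose[OF this cont]
      show "continuous_map (prod_topology ?I ?I) M (\<lambda>z. \<gamma> (run j (snd z)))"
        by (simp add: o_def)
    qed (use run_star[OF j] in auto)
    moreover have "?f1 z = ?f2 z" if "z \<in> topspace (prod_topology ?I ?I)" "snd z = 1 / 2" for z
      using that prev_star[OF j] cur_star[OF j] by (simp add: run_def contraction_0)
    ultimately have "continuous_map (prod_topology ?I ?I) M (\<lambda>z. if snd z \<le> 1 / 2 then ?f1 z else ?f2 z)"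
      using snd_c by (intro continuous_map_cases_le) (auto intro: continuous_map_from_subtopology)
    then show ?thesis
      by (simp add: h_def case_prod_unfold)
  qed
  have h_0: "h \<sigma> j 0 = contraction (c (prev j)) \<sigma> (\<gamma> (t j))" for \<sigma> j
    by (simp add: h_def)
  have h_1: "h \<sigma> j 1 = contraction (c j) \<sigma> (\<gamma> (t (Suc j)))" for \<sigma> j
    by (simp add: h_def run_ends)
  have match: "h \<sigma> j 1 = h \<sigma> (Suc j) 0" for \<sigma> j
    unfolding h_0 h_1 by (simp add: prev_def)
  have cyc: "h \<sigma> (N - 1) 1 = h \<sigma> 0 0" for \<sigma>
    unfolding h_0 h_1 using N ends closed by (simp add: prev_def)
  have "homotopic_closed_curves M (glue N (h 0)) (glue N (h 1))"
    by (rule homotopic_closed_curves_glue) (use cont_h match cyc N in auto)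
  moreover have "homotopic_closed_curves M \<gamma> (\<gamma> \<circ> glue N run)"
  proof (rule homotopic_closed_curves_reparametrise[OF \<gamma>])
    show "continuous_map ?I ?I (glue N run)"
    proof (rule continuous_map_glue_path)
      show "continuous_map ?I ?I (run j)" if "j < N" for j
      proof -
        have "continuous_map ?I euclideanreal (run j)"
          unfolding run_def by (auto intro!: continuous_intros)
        then show ?thesis
          using run01[OF that] by (auto simp: continuous_map_in_subtopology)
      qed
    qed (use N run_ends in auto)
    show "glue N run 0 = 0" "glue N run 1 = 1"
      using N run_ends ends by (simp_all add: glue_0 glue_1)
  qed
  moreover have "homotopic_closed_curves M (\<gamma> \<circ> glue N run) (glue N (h 0))"
  proof (rule homotopic_closed_curves_equal)
    show "closed_curve M (\<gamma> \<circ> glue N run)"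
      using calculation(2) by (rule homotopic_closed_curves_imp_closed_curve(2))
    fix u :: real assume "u \<in> {0..1}"
    then show "(\<gamma> \<circ> glue N run) u = glue N (h 0) u"
    proof (rule glue_cong[rotated -1])
      fix j \<tau> assume j: "j < N" "\<tau> \<in> {0..1::real}"
      have "glue N run ((real j + \<tau>) / real N) = run j \<tau>"
        by (rule glue_eq[OF j]) (simp add: run_ends)
      moreover have "h 0 j \<tau> = \<gamma> (run j \<tau>)"
        unfolding h_def using prev_star[OF j(1)] run_star[OF j] by (auto simp: contraction_0 run_def)
      ultimately show "(\<gamma> \<circ> glue N run) ((real j + \<tau>) / real N) = h 0 j \<tau>"
        by simp
    qed (use match N in auto)
  qed
  ultimately show "homotopic_closed_curves M \<gamma> (glue N (h 1))"
    using homotopic_closed_curves_trans by metis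
qed

text \<open>After the contraction, the \<open>j\<close>-th piece consists of two segments joining \<open>\<gamma> (t j)\<close> to the barycentres of
  two faces dominant at this point. It therefore lifts to a single simplex \<open>s j\<close>, where a straight-line
  homotopy takes it to the segment between the chosen vertices of the two faces. Where consecutive pieces
  meet, the homotopy moves along the path chosen for the class of the common face.

  For \<open>N = 1\<close> the two faces belong to the same class and hence coincide, so that the segment is constant.
  This is what makes short curves null-homotopic.\<close>

lemma homotopic_to_edge_pieces:
  assumes \<gamma>: "closed_curve M \<gamma>" and chain: "star_chain \<gamma> 0 1 N t c" and N: "N > 0"
  obtains s a b where "\<And>j. j < N \<Longrightarrow> s j < num_simplices T \<and> a j \<le> d \<and> b j \<le> d"
    "\<And>j. Suc j < N \<Longrightarrow> cls (s j) (simplex_vertex (b j)) = cls (s (Suc j)) (simplex_vertex (a (Suc j)))"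
    "cls (s (N - 1)) (simplex_vertex (b (N - 1))) = cls (s 0) (simplex_vertex (a 0))"
    "N = 1 \<Longrightarrow> a 0 = b 0"
    "homotopic_closed_curves M \<gamma> (glue N (\<lambda>j \<tau>. cls (s j) (mix (simplex_vertex (a j)) (simplex_vertex (b j)) \<tau>)))"
proof -
  let ?I = "top_of_set {0..1::real}"
  define prev where prev0: "prev = cyclic_pred N"
  define run where run0: "run = late_run t"
  define k where k0: "k = contraction_piece \<gamma> N t c"
  note bary = homotopic_to_barycentric_curve[OF \<gamma> chain N, folded prev0 run0 k0]
  have prev_def: "prev j = (if j = 0 then N - 1 else j - 1)" for j
    by (simp add: prev0 cyclic_pred_def)
  have run_def: "run j \<tau> = t j + max 0 (4 * \<tau> - 3) * (t (Suc j) - t j)" for j \<tau>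
    by (simp add: run0 late_run_def)
  have k_def: "k \<sigma> j \<tau> =
      (if \<tau> \<le> 1 / 2 then contraction (c (prev j)) (\<sigma> * max 0 (1 - 2 * \<tau>)) (\<gamma> (t j))
       else contraction (c j) (\<sigma> * max 0 (min 1 (4 * \<tau> - 2))) (\<gamma> (run j \<tau>)))" for \<sigma> j \<tau>
    by (simp add: k0 contraction_piece_def prev0 run0)
  define lift where "lift j s x G H \<longleftrightarrow> s < num_simplices T \<and> x \<in> standard_simplex d \<and> \<gamma> (t j) = cls s x \<and>
      dominant d {0<..} G x \<and> cls s (barycentre G) = c (prev j) \<and>
      dominant d {0<..} H x \<and> cls s (barycentre H) = c j" for j s x G H
  have "\<exists>q. lift j (fst q) (fst (snd q)) (fst (snd (snd q))) (snd (snd (snd q)))" if j: "j < N" for j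
  proof -
    have "\<gamma> (t j) \<in> topspace M"
      using bary(2)[OF j] star_subset by blast
    then obtain s x where sx: "\<gamma> (t j) = cls s x" "s < num_simplices T" "x \<in> standard_simplex d"
      by (rule topspace_M_cases)
    obtain G where "dominant d {0<..} G x" "cls s (barycentre G) = c (prev j)"
      using star_representative[OF _ sx(2,3) order_refl, of "c (prev j)"] bary(2)[OF j] sx(1) by auto
    moreover obtain H where "dominant d {0<..} H x" "cls s (barycentre H) = c j"
      using star_representative[OF _ sx(2,3) order_refl, of "c j"] bary(2)[OF j] sx(1) by auto
    ultimately show ?thesis
      using sx by (intro exI[of _ "(s, x, G, H)"]) (simp add: lift_def)
  qed
  then obtain q where q: "\<And>j. j < N \<Longrightarrow>
      lift j (fst (q j)) (fst (snd (q j))) (fst (snd (snd (q j)))) (snd (snd (snd (q j))))"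
    by metis
  define s where "s j = fst (q j)" for j
  define x where "x j = fst (snd (q j))" for j
  define G where "G j = fst (snd (snd (q j)))" for j
  define H where "H j = snd (snd (snd (q j)))" for j
  have s: "s j < num_simplices T"
    and x: "x j \<in> standard_simplex d" "\<gamma> (t j) = cls (s j) (x j)"
    and G: "dominant d {0<..} (G j) (x j)" "cls (s j) (barycentre (G j)) = c (prev j)"
    and H: "dominant d {0<..} (H j) (x j)" "cls (s j) (barycentre (H j)) = c j" if "j < N" for j
    using q[OF that] by (simp_all add: lift_def s_def x_def G_def H_def)
  have G': "G j \<noteq> {}" "G j \<subseteq> {..d}" and H': "H j \<noteq> {}" "H j \<subseteq> {..d}" if "j < N" for j
    using G(1)[OF that] H(1)[OF that] by (simp_all add: dominant_def)
  show ?thesis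
  proof (rule ex_compatible_vertices)
    fix A :: "nat \<Rightarrow> nat set \<Rightarrow> nat" assume A: "\<And>s F. s < num_simplices T \<Longrightarrow> F \<noteq> {} \<Longrightarrow> F \<subseteq> {..d} \<Longrightarrow> A s F \<in> F"
      and A_compat: "\<And>s F s' F' \<sigma>. s < num_simplices T \<Longrightarrow> F \<noteq> {} \<Longrightarrow> F \<subseteq> {..d} \<Longrightarrow>
        s' < num_simplices T \<Longrightarrow> F' \<noteq> {} \<Longrightarrow> F' \<subseteq> {..d} \<Longrightarrow>
        cls s (barycentre F) = cls s' (barycentre F') \<Longrightarrow> \<sigma> \<in> {0..1} \<Longrightarrow>
        cls s (mix (barycentre F) (simplex_vertex (A s F)) \<sigma>) =
          cls s' (mix (barycentre F') (simplex_vertex (A s' F')) \<sigma>)"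
    define a where "a j = A (s j) (G j)" for j
    define b where "b j = A (s j) (H j)" for j
    have ab: "a j \<le> d" "b j \<le> d" if "j < N" for j
      using A[OF s[OF that] G'[OF that]] A[OF s[OF that] H'[OF that]] G'(2)[OF that] H'(2)[OF that]
      unfolding a_def b_def by auto
    \<comment> \<open>At most one of the two parameters is nonzero at any time, so this is the broken line from one barycentre over \<open>x j\<close> to the other.\<close>
    define \<xi> where "\<xi> j \<tau> = mix (mix (x j) (barycentre (G j)) (max 0 (1 - 2 * \<tau>))) (barycentre (H j))
        (max 0 (min 1 (4 * \<tau> - 2)))" for j \<tau>
    define h where "h \<sigma> j \<tau> = cls (s j) (mix (\<xi> j \<tau>) (mix (simplex_vertex (a j)) (simplex_vertex (b j)) \<tau>) \<sigma>)" for \<sigma> j \<tau>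
    have GH: "cls (s j) (mix (barycentre (H j)) (simplex_vertex (b j)) \<sigma>) =
        cls (s i) (mix (barycentre (G i)) (simplex_vertex (a i)) \<sigma>)"
      if "i < N" "j < N" "prev i = j" "\<sigma> \<in> {0..1}" for i j \<sigma>
      unfolding a_def b_def
      using s[OF that(1)] s[OF that(2)] G'[OF that(1)] H'[OF that(2)] G(2)[OF that(1)] H(2)[OF that(2)] that(3,4)
      by (intro A_compat) auto
    have h_0: "h \<sigma> j 0 = cls (s j) (mix (barycentre (G j)) (simplex_vertex (a j)) \<sigma>)" for \<sigma> j
      by (simp add: h_def \<xi>_def)
    have h_1: "h \<sigma> j 1 = cls (s j) (mix (barycentre (H j)) (simplex_vertex (b j)) \<sigma>)" for \<sigma> j
      by (simp add: h_def \<xi>_def)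
    have match: "h \<sigma> j 1 = h \<sigma> (Suc j) 0" if "Suc j < N" "\<sigma> \<in> {0..1}" for \<sigma> j
      unfolding h_0 h_1 using that by (intro GH) (auto simp: prev_def)
    have cyc: "h \<sigma> (N - 1) 1 = h \<sigma> 0 0" if "\<sigma> \<in> {0..1}" for \<sigma>
      unfolding h_0 h_1 using that N by (intro GH) (auto simp: prev_def)
    have fst_c: "continuous_map (prod_topology ?I ?I) euclideanreal fst"
      and snd_c: "continuous_map (prod_topology ?I ?I) euclideanreal snd"
      using continuous_map_fst continuous_map_snd continuous_map_into_fulltopology by blast+
    have cont: "continuous_map (prod_topology ?I ?I) M (\<lambda>(\<sigma>, \<tau>). h \<sigma> j \<tau>)" if j: "j < N" for j
    proof -
      have "continuous_map (prod_topology ?I ?I) M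
          (\<lambda>z. cls (s j) (mix (\<xi> j (snd z)) (mix (simplex_vertex (a j)) (simplex_vertex (b j)) (snd z)) (fst z)))"
      proof (rule continuous_map_cls_const[OF s[OF j]])
        show "continuous_map (prod_topology ?I ?I) euclideanreal
            (\<lambda>z. mix (\<xi> j (snd z)) (mix (simplex_vertex (a j)) (simplex_vertex (b j)) (snd z)) (fst z) i)" for i
          unfolding \<xi>_def mix_def by (intro continuous_intros fst_c snd_c) auto
        show "(\<lambda>z. mix (\<xi> j (snd z)) (mix (simplex_vertex (a j)) (simplex_vertex (b j)) (snd z)) (fst z))
            \<in> topspace (prod_topology ?I ?I) \<rightarrow> standard_simplex d"
          unfolding \<xi>_def using x(1)[OF j] dominant_barycentre[OF G(1)[OF j]] dominant_barycentre[OF H(1)[OF j]] ab[OF j]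
          by (intro Pi_I mix_in_standard_simplex simplex_vertex_in_standard_simplex) auto
      qed
      then show ?thesis by (simp add: h_def case_prod_unfold)
    qed
    have "homotopic_closed_curves M (glue N (h 0)) (glue N (h 1))"
      by (rule homotopic_closed_curves_glue) (use cont match cyc N in auto)
    moreover have "glue N (k 1) u = glue N (h 0) u" if u01: "u \<in> {0..1}" for u
    proof -
      obtain j \<tau> where j: "j < N" "\<tau> \<in> {0..1}" and u: "u = (real j + \<tau>) / real N"
        using unit_interval_pieces[OF N u01] .
      have "k 1 i 1 = k 1 (Suc i) 0" if "Suc i < N" for i
        unfolding k_def by (simp add: prev_def run_def)
      then have "glue N (k 1) u = k 1 j \<tau>"
        unfolding u using j by (intro glue_eq)
      also have "\<dots> = h 0 j \<tau>"
      proof (cases "\<tau> \<le> 1 / 2")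
        case True
        have "contraction (c (prev j)) (max 0 (1 - 2 * \<tau>)) (\<gamma> (t j)) =
            cls (s j) (mix (x j) (barycentre (G j)) (max 0 (1 - 2 * \<tau>)))"
          unfolding x(2)[OF j(1)] G(2)[OF j(1), symmetric] using j(2) True
          by (intro contraction_cls s x G j(1)) auto
        then show ?thesis
          using True by (simp add: k_def h_def \<xi>_def)
      next
        case False
        have "contraction (c j) (max 0 (min 1 (4 * \<tau> - 2))) (\<gamma> (run j \<tau>)) =
            cls (s j) (mix (x j) (barycentre (H j)) (max 0 (min 1 (4 * \<tau> - 2))))"
        proof (cases "\<tau> \<le> 3 / 4")
          case True
          then have "run j \<tau> = t j" by (simp add: run_def)
          then show ?thesis
            unfolding H(2)[OF j(1), symmetric] using False
            by (simp only: x(2)[OF j(1)]) (intro contraction_cls s x H j(1), auto)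
        next
          case False
          then have "max 0 (min 1 (4 * \<tau> - 2)) = 1" by simp
          then show ?thesis
            using contraction_1[OF bary(3)[OF j]] H(2)[OF j(1)] by simp
        qed
        then show ?thesis
          using False by (simp add: k_def h_def \<xi>_def)
      qed
      also have "\<dots> = glue N (h 0) u"
        unfolding u using j match by (intro glue_eq[symmetric]) auto
      finally show ?thesis .
    qed
    then have "homotopic_closed_curves M (glue N (k 1)) (glue N (h 0))"
      using homotopic_closed_curves_imp_closed_curve(2)[OF bary(1)]
      by (intro homotopic_closed_curves_equal)
    ultimately have "homotopic_closed_curves M \<gamma> (glue N (h 1))"
      using homotopic_closed_curves_trans[OF bary(1)] homotopic_closed_curves_trans by metis
    moreover have "h 1 = (\<lambda>j \<tau>. cls (s j) (mix (simplex_vertex (a j)) (simplex_vertex (b j)) \<tau>))"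
      by (simp add: h_def fun_eq_iff)
    moreover have "a 0 = b 0" if "N = 1"
    proof -
      have "card (G 0) = card (H 0)"
        using barycentre_cls_card[of "s 0" "G 0" "s 0" "H 0"] G(2)[of 0] H(2)[of 0] s[of 0] G'[of 0] H'[of 0] that
        by (simp add: prev_def)
      then have "G 0 = H 0"
        using dominant_unique[OF G(1) H(1)] N by blast
      then show ?thesis by (simp add: a_def b_def)
    qed
    moreover have "cls (s j) (simplex_vertex (b j)) = cls (s (Suc j)) (simplex_vertex (a (Suc j)))" if "Suc j < N" for j
      using match[OF that, of 1] unfolding h_0 h_1 by simp
    moreover have "cls (s (N - 1)) (simplex_vertex (b (N - 1))) = cls (s 0) (simplex_vertex (a 0))"
      using cyc[of 1] unfolding h_0 h_1 by simp
    ultimately show ?thesis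
      using s ab by (intro that[of s a b]) auto
  qed
qed

end

section \<open>Closed walks in the one-skeleton\<close>

lemma cas_snoc:
  assumes "pre_digraph.cas G u p x" "tail G e = x"
  shows "pre_digraph.cas G u (p @ [e]) (head G e)"
  using assms by (induction p arbitrary: u) (auto simp: pre_digraph.cas.simps)

lemma cas_consecutive:
  assumes "pre_digraph.cas G u p v" "Suc i < length p"
  shows "head G (p ! i) = tail G (p ! Suc i)"
  using assms
proof (induction p arbitrary: u i)
  case (Cons e p)
  then obtain e' p' where p: "p = e' # p'" by (cases p) auto
  show ?case
    using Cons by (cases i) (auto simp: pre_digraph.cas.simps p)
qed simp

lemma cas_first:
  assumes "pre_digraph.cas G u p v" "p \<noteq> []"
  shows "tail G (p ! 0) = u"
  using assms by (cases p) (auto simp: pre_digraph.cas.simps)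

lemma cas_last:
  assumes "pre_digraph.cas G u p v" "p \<noteq> []"
  shows "head G (p ! (length p - 1)) = v"
  using assms
proof (induction p arbitrary: u)
  case (Cons e p)
  then show ?case
    by (cases "p = []") (auto simp: pre_digraph.cas.simps nth_Cons')
qed simp

lemma filter_upt_nth:
  assumes "j < N" "P j"
  shows "filter P [0..<N] ! length (filter P [0..<j]) = j"
    and "length (filter P [0..<j]) < length (filter P [0..<N])"
proof -
  have "[0..<N] = [0..<j] @ j # [Suc j..<N]"
    using upt_add_eq_append[of 0 j "N - j"] upt_conv_Cons[OF assms(1)] assms(1) by simp
  then have "filter P [0..<N] = filter P [0..<j] @ j # filter P [Suc j..<N]"
    using assms(2) by simp
  then show "filter P [0..<N] ! length (filter P [0..<j]) = j"
    and "length (filter P [0..<j]) < length (filter P [0..<N])"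
    by (simp_all add: nth_append)
qed

context glued_simplices
begin

lemma edge_curve_eq_mix:
  "t \<in> {0..1} \<Longrightarrow> edge_curve d T s a b t = cls s (mix (simplex_vertex a) (simplex_vertex b) t)"
  by (simp add: edge_curve_def mix_def)

lemma continuous_map_edge:
  assumes "s < num_simplices T" "a \<le> d" "b \<le> d"
  shows "continuous_map (top_of_set {0..1}) M (\<lambda>t. cls s (mix (simplex_vertex a) (simplex_vertex b) t))"
proof (rule continuous_map_cls_const[OF assms(1)])
  show "continuous_map (top_of_set {0..1}) euclideanreal (\<lambda>t. mix (simplex_vertex a) (simplex_vertex b) t i)" for i
    unfolding mix_def by (auto intro!: continuous_intros)
  show "mix (simplex_vertex a) (simplex_vertex b) \<in> topspace (top_of_set {0..1}) \<rightarrow> standard_simplex d"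
    using assms(2,3) by (auto intro!: mix_in_standard_simplex simplex_vertex_in_standard_simplex)
qed

text \<open>Segments that are constant contribute no arc and are removed. The glued curve is the curve running
  through the remaining arcs composed with a monotone map of the interval that is constant on the removed
  pieces.\<close>

lemma ex_closed_walk_of_edge_pieces:
  fixes s a b :: "nat \<Rightarrow> nat"
  defines "g \<equiv> \<lambda>j \<tau>. cls (s j) (mix (simplex_vertex (a j)) (simplex_vertex (b j)) \<tau>)"
  assumes N: "N > 0"
    and sab: "\<And>j. j < N \<Longrightarrow> s j < num_simplices T \<and> a j \<le> d \<and> b j \<le> d"
    and match: "\<And>j. Suc j < N \<Longrightarrow> cls (s j) (simplex_vertex (b j)) = cls (s (Suc j)) (simplex_vertex (a (Suc j)))"
    and cyc: "cls (s (N - 1)) (simplex_vertex (b (N - 1))) = cls (s 0) (simplex_vertex (a 0))"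
  shows "\<exists>v w \<gamma>'. traverses_closed_walk d T v w \<gamma>' \<and> homotopic_closed_curves M (glue N g) \<gamma>' \<and>
    length w = length (filter (\<lambda>j. a j \<noteq> b j) [0..<N])"
proof -
  let ?I = "top_of_set {0..1::real}"
  let ?G = "one_skeleton d T"
  define P where "P = (\<lambda>j. a j \<noteq> b j)"
  define E where "E j = edge_curve d T (s j) (a j) (b j)" for j
  define w where "w = map E (filter P [0..<N])"
  define n where "n = length w"
  define k where "k j = length (filter P [0..<j])" for j
  define V where "V j = (if j = N then g 0 0 else g j 0)" for j
  have g_0: "g j 0 = cls (s j) (simplex_vertex (a j))" and g_1: "g j 1 = cls (s j) (simplex_vertex (b j))" for j
    by (simp_all add: g_def)
  have g_match: "g j 1 = g (Suc j) 0" if "Suc j < N" for j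
    using match[OF that] by (simp add: g_0 g_1)
  have g_cyc: "g (N - 1) 1 = g 0 0"
    using cyc by (simp add: g_0 g_1)
  have V_0: "V 0 = g 0 0" and V_N: "V N = g 0 0"
    by (simp_all add: V_def)
  have V: "g j 0 = V j" "g j 1 = V (Suc j)" if "j < N" for j
  proof -
    show "g j 0 = V j" using that by (simp add: V_def)
    show "g j 1 = V (Suc j)"
    proof (cases "Suc j < N")
      case True
      then show ?thesis using g_match[OF True] by (simp add: V_def)
    next
      case False
      then have "Suc j = N" "j = N - 1" using that by auto
      then show ?thesis using g_cyc by (simp add: V_def)
    qed
  qed
  have cont_g: "continuous_map ?I M (g j)" if "j < N" for j
    unfolding g_def using sab[OF that] by (intro continuous_map_edge) auto
  have E: "E j \<tau> = g j \<tau>" if "\<tau> \<in> {0..1}" for j \<tau>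
    unfolding E_def g_def by (rule edge_curve_eq_mix[OF that])
  have k_0: "k 0 = 0" and k_Suc: "k (Suc j) = k j + (if P j then 1 else 0)" and k_N: "k N = n" for j
    by (simp_all add: k_def n_def w_def)
  have w_nth: "w ! k j = E j" "k j < n" if "j < N" "P j" for j
    using filter_upt_nth[of j N P] that by (simp_all add: w_def k_def n_def)
  have w_E: "\<exists>j<N. e = E j" if "e \<in> set w" for e
    using that by (auto simp: w_def)
  have skeleton: "tail ?G e = e 0" "head ?G e = e 1" for e
    by (simp_all add: one_skeleton_def)
  have cas_upto: "pre_digraph.cas ?G (V 0) (map E (filter P [0..<j])) (V j)" if "j \<le> N" for j
    using that
  proof (induction j)
    case 0
    show ?case by (simp add: pre_digraph.cas.simps)
  next
    case (Suc j)
    then have IH: "pre_digraph.cas ?G (V 0) (map E (filter P [0..<j])) (V j)" and j: "j < N" by auto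
    show ?case
    proof (cases "P j")
      case True
      have "pre_digraph.cas ?G (V 0) (map E (filter P [0..<j]) @ [E j]) (head ?G (E j))"
        by (rule cas_snoc[OF IH]) (simp add: skeleton E V(1)[OF j])
      then show ?thesis
        using True by (simp add: skeleton E V(2)[OF j])
    next
      case False
      then have "V (Suc j) = V j"
        using V[OF j] by (simp add: P_def g_def)
      then show ?thesis using IH False by simp
    qed
  qed
  then have cas: "pre_digraph.cas ?G (V 0) w (V 0)"
    using V_0 V_N unfolding w_def by (metis order_refl)
  have walk: "pre_digraph.awalk ?G (V 0) w (V 0)"
    unfolding pre_digraph.awalk_def
  proof (intro conjI subsetI)
    show "V 0 \<in> verts ?G"
      using sab[OF N] by (auto simp: one_skeleton_def V_0 g_0)
    show "e \<in> arcs ?G" if "e \<in> set w" for e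
      using that sab by (auto simp: one_skeleton_def w_def E_def P_def)
  qed (rule cas)
  have closed_g: "closed_curve M (glue N g)"
    by (rule closed_curve_glue) (use cont_g g_match g_cyc N in auto)
  show ?thesis
  proof (cases "n = 0")
    case True
    then have w: "w = []" by (simp add: n_def)
    have notP: "\<not> P j" if "j < N" for j
      using w_nth(2)[OF that] True by auto
    have const: "V j = V 0" if "j \<le> N" for j
      using that
    proof (induction j)
      case (Suc j)
      then have "a j = b j" "V j = V 0" using notP[of j] by (auto simp: P_def)
      then show ?case using V[of j] Suc.prems by (simp add: g_def)
    qed simp
    have "glue N g u = V 0" if u01: "u \<in> {0..1}" for u
    proof -
      obtain j \<tau> where j: "j < N" "\<tau> \<in> {0..1}" "u = (real j + \<tau>) / real N"
        using unit_interval_pieces[OF N u01] .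
      then have "glue N g u = g j \<tau>"
        using g_match by (simp add: glue_eq)
      also have "\<dots> = g j 0"
        using notP[OF j(1)] by (simp add: P_def g_def)
      finally show ?thesis
        using V(1)[OF j(1)] const[of j] j(1) by simp
    qed
    then have "homotopic_closed_curves M (glue N g) (\<lambda>_. V 0)"
      by (intro homotopic_closed_curves_equal closed_g)
    moreover have "traverses_closed_walk d T (V 0) w (\<lambda>_. V 0)"
      using walk by (simp add: traverses_closed_walk_def w)
    moreover have "length w = length (filter (\<lambda>j. a j \<noteq> b j) [0..<N])"
      by (simp add: w_def P_def)
    ultimately show ?thesis by blast
  next
    case False
    then have n: "n > 0" and w_ne: "w \<noteq> []" by (auto simp: n_def)
    define \<gamma>' where "\<gamma>' = glue n (\<lambda>i. w ! i)"
    have w_match: "(w ! i) 1 = (w ! Suc i) 0" if "Suc i < n" for i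
      using cas_consecutive[OF cas, of i] that by (simp add: skeleton n_def)
    have w_first: "(w ! 0) 0 = V 0"
      using cas_first[OF cas w_ne] by (simp add: skeleton)
    have w_last: "(w ! (n - 1)) 1 = V 0"
      using cas_last[OF cas w_ne] by (simp add: skeleton n_def)
    have \<gamma>'_piece: "\<gamma>' ((real i + \<tau>) / real n) = (w ! i) \<tau>" if "i < n" "\<tau> \<in> {0..1}" for i \<tau>
      unfolding \<gamma>'_def using that w_match by (intro glue_eq) auto
    have cont_w: "continuous_map ?I M (w ! i)" if "i < n" for i
    proof -
      have "w ! i \<in> set w" using that by (simp add: n_def)
      then obtain j where j: "j < N" "w ! i = E j" using w_E by blast
      have "continuous_map ?I M (E j)"
        by (rule continuous_map_eq[OF cont_g[OF j(1)]]) (simp add: E)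
      then show ?thesis by (simp add: j(2))
    qed
    have closed_\<gamma>': "closed_curve M \<gamma>'"
      unfolding \<gamma>'_def by (rule closed_curve_glue) (use cont_w w_match w_first w_last n in auto)
    have traverses: "traverses_closed_walk d T (V 0) w \<gamma>'"
      unfolding traverses_closed_walk_def using walk w_ne \<gamma>'_piece by (simp add: n_def)
    define r where "r j \<tau> = (real (k j) + (if P j then \<tau> else 0)) / real n" for j \<tau>
    have r_match: "r j 1 = r (Suc j) 0" for j
      by (simp add: r_def k_Suc)
    have k_mono: "k j \<le> n" if "j \<le> N" for j
    proof -
      have "k i \<le> k (i + m)" for i m
        by (induction m) (auto simp: k_Suc)
      from this[of j "N - j"] show ?thesis using that k_N by simp
    qed
    have r01: "r j \<tau> \<in> {0..1}" if "j < N" "\<tau> \<in> {0..1}" for j \<tau>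
      using that k_mono[of j] w_nth(2)[OF that(1)] n by (auto simp: r_def field_simps)
    have homotopic: "homotopic_closed_curves M \<gamma>' (\<gamma>' \<circ> glue N r)"
    proof (rule homotopic_closed_curves_reparametrise[OF closed_\<gamma>'])
      show "continuous_map ?I ?I (glue N r)"
      proof (rule continuous_map_glue_path)
        show "continuous_map ?I ?I (r j)" if "j < N" for j
        proof -
          have "continuous_map ?I euclideanreal (r j)"
            unfolding r_def using n by (cases "P j") (auto intro!: continuous_intros)
          then show ?thesis
            using r01[OF that] by (auto simp: continuous_map_in_subtopology)
        qed
      qed (use r_match N in auto)
      show "glue N r 0 = 0"
        using N by (simp add: glue_0 r_def k_0)
      have "glue N r 1 = r (Suc (N - 1)) 0"
        using N r_match by (simp add: glue_1)
      then show "glue N r 1 = 1"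
        using N n k_N by (simp add: r_def)
    qed
    have \<gamma>'_vertex: "\<gamma>' (real (k j) / real n) = V j" if "j \<le> N" for j
      using that
    proof (induction j)
      case 0
      show ?case
        using \<gamma>'_piece[OF n, of 0] w_first by (simp add: k_0)
    next
      case (Suc j)
      then have j: "j < N" by simp
      show ?case
      proof (cases "P j")
        case True
        then have "\<gamma>' (real (k (Suc j)) / real n) = (w ! k j) 1"
          using \<gamma>'_piece[OF w_nth(2)[OF j True], of 1] by (simp add: k_Suc add.commute)
        then show ?thesis
          using w_nth(1)[OF j True] V(2)[OF j] by (simp add: E)
      next
        case False
        then have "V (Suc j) = V j"
          using V[OF j] by (simp add: P_def g_def)
        then show ?thesis
          using Suc False by (simp add: k_Suc)
      qed
    qed
    have "glue N g u = (\<gamma>' \<circ> glue N r) u" if u01: "u \<in> {0..1}" for u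
    proof -
      obtain j \<tau> where j: "j < N" "\<tau> \<in> {0..1}" and u: "u = (real j + \<tau>) / real N"
        using unit_interval_pieces[OF N u01] .
      have "glue N r u = r j \<tau>"
        unfolding u using j r_match by (intro glue_eq)
      moreover have "\<gamma>' (r j \<tau>) = g j \<tau>"
      proof (cases "P j")
        case True
        then show ?thesis
          using \<gamma>'_piece[OF w_nth(2)[OF j(1) True] j(2)] w_nth(1)[OF j(1) True] E[OF j(2)] by (simp add: r_def)
      next
        case False
        then have "g j \<tau> = g j 0" by (simp add: P_def g_def)
        then show ?thesis
          using False \<gamma>'_vertex[of j] j(1) V(1)[OF j(1)] by (simp add: r_def)
      qed
      moreover have "glue N g u = g j \<tau>"
        unfolding u using j g_match by (intro glue_eq)
      ultimately show ?thesis by simp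
    qed
    then have "homotopic_closed_curves M (glue N g) (\<gamma>' \<circ> glue N r)"
      by (intro homotopic_closed_curves_equal closed_g)
    then have "homotopic_closed_curves M (glue N g) \<gamma>'"
      using homotopic unfolding homotopic_closed_curves_def
      by (rule homotopic_with_trans[OF _ homotopic_with_symD])
    moreover have "length w = length (filter (\<lambda>j. a j \<noteq> b j) [0..<N])"
      by (simp add: w_def P_def)
    ultimately show ?thesis using traverses by blast
  qed
qed

text \<open>At most \<open>N\<close> arcs remain, and none if \<open>N = 1\<close>; so their number is at most \<open>2 (N - 1)\<close>, which is bounded by
  a multiple of the length without an additive constant.\<close>

lemma ex_homotopic_closed_walk:
  assumes \<kappa>: "\<kappa> > 0" and \<delta>: "\<delta> = 1 / ((real d + 1) * (real d + 2)) * sqrt \<kappa> / 4"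
    and \<gamma>: "closed_curve M \<gamma>"
  shows "\<exists>v w \<gamma>'. traverses_closed_walk d T v w \<gamma>' \<and> homotopic_closed_curves M \<gamma> \<gamma>' \<and>
    of_nat (length w) \<le> ennreal (2 / \<delta>) * curve_length d T (flat_metric d \<kappa>) \<gamma>"
proof -
  have \<delta>_pos: "\<delta> > 0" using \<kappa> by (simp add: \<delta>)
  let ?L = "curve_length d T (flat_metric d \<kappa>) \<gamma>"
  obtain N t c where chain: "star_chain \<gamma> 0 1 N t c" and N: "N > 0"
    and short: "of_nat (N - 1) * ennreal \<delta> \<le> ?L"
    using ex_short_star_chain[OF _ \<kappa> \<delta>, of \<gamma>] \<gamma> unfolding closed_curve_def by blast
  show ?thesis
  proof (rule homotopic_to_edge_pieces[OF \<gamma> chain N])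
    fix s a b :: "nat \<Rightarrow> nat"
    assume sab: "\<And>j. j < N \<Longrightarrow> s j < num_simplices T \<and> a j \<le> d \<and> b j \<le> d"
      and match: "\<And>j. Suc j < N \<Longrightarrow> cls (s j) (simplex_vertex (b j)) = cls (s (Suc j)) (simplex_vertex (a (Suc j)))"
      and cyc: "cls (s (N - 1)) (simplex_vertex (b (N - 1))) = cls (s 0) (simplex_vertex (a 0))"
      and one: "N = 1 \<Longrightarrow> a 0 = b 0"
      and hom: "homotopic_closed_curves M \<gamma>
        (glue N (\<lambda>j \<tau>. cls (s j) (mix (simplex_vertex (a j)) (simplex_vertex (b j)) \<tau>)))"
    obtain v w \<gamma>' where w: "traverses_closed_walk d T v w \<gamma>'"
      "homotopic_closed_curves M (glue N (\<lambda>j \<tau>. cls (s j) (mix (simplex_vertex (a j)) (simplex_vertex (b j)) \<tau>))) \<gamma>'"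
      "length w = length (filter (\<lambda>j. a j \<noteq> b j) [0..<N])"
      using ex_closed_walk_of_edge_pieces[OF N sab match cyc] by blast
    have "length w \<le> N"
      using w(3) length_filter_le[of "\<lambda>j. a j \<noteq> b j" "[0..<N]"] by simp
    moreover have "length w = 0" if "N = 1"
      using w(3) one[OF that] that by simp
    ultimately have "length w \<le> 2 * (N - 1)"
      using N by (cases "N = 1") auto
    then have "of_nat (length w) \<le> (of_nat (2 * (N - 1)) :: ennreal)"
      by (rule of_nat_mono)
    also have "\<dots> = ennreal (2 / \<delta>) * (of_nat (N - 1) * ennreal \<delta>)"
    proof -
      have "real (2 * (N - 1)) = 2 / \<delta> * (real (N - 1) * \<delta>)"
        using \<delta>_pos by simp
      then have "ennreal (real (2 * (N - 1))) = ennreal (2 / \<delta> * (real (N - 1) * \<delta>))"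
        by (rule arg_cong)
      also have "\<dots> = ennreal (2 / \<delta>) * (ennreal (real (N - 1)) * ennreal \<delta>)"
        using \<delta>_pos by (simp only: ennreal_mult divide_nonneg_nonneg mult_nonneg_nonneg less_imp_le of_nat_0_le_iff zero_le_numeral)
      finally show ?thesis
        by (simp only: ennreal_of_nat_eq_real_of_nat)
    qed
    also have "\<dots> \<le> ennreal (2 / \<delta>) * ?L"
      by (intro mult_left_mono short) simp
    finally show ?thesis
      using w(1) homotopic_closed_curves_trans[OF hom w(2)] by blast
  qed
qed

end

theorem theoremA1:
  fixes d :: nat
  shows "\<exists>C::real. C > 0 \<and>
    (\<forall>T. triangulated_closed_manifold d T \<longrightarrow>
      (\<exists>m. piecewise_riemannian_metric d T m \<and>
        volume d T m = of_nat (num_simplices T) \<and>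
        (\<forall>\<gamma>. closed_curve (underlying_space d T) \<gamma> \<longrightarrow>
          (\<exists>v w \<gamma>'. traverses_closed_walk d T v w \<gamma>' \<and>
            homotopic_closed_curves (underlying_space d T) \<gamma> \<gamma>' \<and>
            of_nat (length w) \<le> ennreal C * curve_length d T m \<gamma>))))"
proof -
  obtain \<kappa> where \<kappa>: "\<kappa> > 0" "\<And>T. volume d T (flat_metric d \<kappa>) = of_nat (num_simplices T)"
    using ex_flat_metric_unit_volume by blast
  define \<delta> where "\<delta> = 1 / ((real d + 1) * (real d + 2)) * sqrt \<kappa> / 4"
  have "2 / \<delta> > 0" using \<kappa>(1) by (simp add: \<delta>_def)
  show ?thesis
  proof (intro exI[of _ "2 / \<delta>"] conjI allI impI)
    fix T assume "triangulated_closed_manifold d T"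
    then have T: "is_gluing d T" by (simp add: triangulated_closed_manifold_def)
    then interpret glued_simplices d T by unfold_locales
    show "\<exists>m. piecewise_riemannian_metric d T m \<and> volume d T m = of_nat (num_simplices T) \<and>
        (\<forall>\<gamma>. closed_curve M \<gamma> \<longrightarrow> (\<exists>v w \<gamma>'. traverses_closed_walk d T v w \<gamma>' \<and>
          homotopic_closed_curves M \<gamma> \<gamma>' \<and> of_nat (length w) \<le> ennreal (2 / \<delta>) * curve_length d T m \<gamma>))"
    proof (intro exI[of _ "flat_metric d \<kappa>"] conjI allI impI)
      show "piecewise_riemannian_metric d T (flat_metric d \<kappa>)"
        using T \<kappa>(1) by (rule piecewise_riemannian_flat_metric)
      show "volume d T (flat_metric d \<kappa>) = of_nat (num_simplices T)"
        by (rule \<kappa>(2))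
      show "\<exists>v w \<gamma>'. traverses_closed_walk d T v w \<gamma>' \<and> homotopic_closed_curves M \<gamma> \<gamma>' \<and>
          of_nat (length w) \<le> ennreal (2 / \<delta>) * curve_length d T (flat_metric d \<kappa>) \<gamma>" if "closed_curve M \<gamma>" for \<gamma>
        using \<kappa>(1) \<delta>_def that by (rule ex_homotopic_closed_walk)
    qed
  qed (rule \<open>2 / \<delta> > 0\<close>)
qed

end
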